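(* Let $T$ be a tree. The Euler characteristic of the complex variety $X_T^{\mathtt{versal}}$ is $\operatorname{vc}(T)$, the number of minimum vertex covers of $T$.
   Context: A tree is a finite connected simply-connected graph. A vertex cover of a tree $T$ is a set of vertices meeting every edge; a minimum vertex cover is one of minimal cardinality; $\operatorname{vc}(T)$ denotes the number of minimum vertex covers of $T$, which is also the number of maximum independent sets (sets of pairwise non-adjacent vertices of maximal cardinality). A matching of $T$ is a set of edges such that every vertex lies in at most one of them; a maximum matching is one of maximal cardinality. Choose a maximum matching $M$ of $T$. $X_T^{\mathtt{versal}}$ is the affine scheme over $\mathbb{C}$ with variables $x_i,x'_i$ for all vertices $i$ of $T$ and $\alpha_i$ for all vertices $i$ not covered by $M$, defined by the equations $x_ix'_i=1+\alpha_i\prod_jx_j$ for all vertices $i$ (product over the vertices $j$ adjacent to $i$) and the condition that all variables $\alpha_i$ are invertible; here $\alpha_i=1$ whenever $i$ is covered by $M$. Different choices of $M$ lead to isomorphic varieties. The Euler characteristic is that of the topological space of complex points. *)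

theory Defs
  imports "HOL-Analysis.Analysis" "HOL-Homology.Homology"
begin

section \<open>Graphs and trees\<close>

text \<open>
  A graph is given by its vertex set \<open>V\<close> and its set \<open>E\<close> of edges, an edge being a set of two
  vertices. (In \<open>Graph_Theory\<close> the cycles are directed, so that a symmetric digraph with an arc
  always has one; its notion of tree is therefore not the one for undirected graphs.)
\<close>

definition finite_graph :: "'v set \<Rightarrow> 'v set set \<Rightarrow> bool" where
  "finite_graph V E \<longleftrightarrow> finite V \<and> (\<forall>e\<in>E. e \<subseteq> V \<and> card e = 2)"

definition adjacent :: "'v set set \<Rightarrow> 'v \<Rightarrow> 'v \<Rightarrow> bool" where
  "adjacent E u v \<longleftrightarrow> {u, v} \<in> E"

definition graph_connected :: "'v set \<Rightarrow> 'v set set \<Rightarrow> bool" where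
  "graph_connected V E \<longleftrightarrow> V \<noteq> {} \<and> (\<forall>u\<in>V. \<forall>v\<in>V. (adjacent E)\<^sup>*\<^sup>* u v)"

definition graph_cycle :: "'v set set \<Rightarrow> 'v list \<Rightarrow> bool" where
  "graph_cycle E vs \<longleftrightarrow>
     length vs \<ge> 3 \<and> distinct vs \<and> successively (adjacent E) vs \<and> adjacent E (last vs) (hd vs)"

text \<open>A connected graph, as a one-dimensional complex, is simply connected iff it has no cycle.\<close>

definition is_tree :: "'v set \<Rightarrow> 'v set set \<Rightarrow> bool" where
  "is_tree V E \<longleftrightarrow> finite_graph V E \<and> graph_connected V E \<and> (\<nexists>vs. graph_cycle E vs)"

definition vertex_cover :: "'v set \<Rightarrow> 'v set set \<Rightarrow> 'v set \<Rightarrow> bool" where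
  "vertex_cover V E C \<longleftrightarrow> C \<subseteq> V \<and> (\<forall>e\<in>E. C \<inter> e \<noteq> {})"

definition minimum_vertex_cover :: "'v set \<Rightarrow> 'v set set \<Rightarrow> 'v set \<Rightarrow> bool" where
  "minimum_vertex_cover V E C \<longleftrightarrow>
     vertex_cover V E C \<and> (\<forall>D. vertex_cover V E D \<longrightarrow> card C \<le> card D)"

definition vc :: "'v set \<Rightarrow> 'v set set \<Rightarrow> nat" where
  "vc V E = card {C. minimum_vertex_cover V E C}"

definition matching :: "'v set \<Rightarrow> 'v set set \<Rightarrow> 'v set set \<Rightarrow> bool" where
  "matching V E M \<longleftrightarrow> M \<subseteq> E \<and> (\<forall>v\<in>V. \<forall>e\<in>M. \<forall>f\<in>M. v \<in> e \<and> v \<in> f \<longrightarrow> e = f)"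

definition maximum_matching :: "'v set \<Rightarrow> 'v set set \<Rightarrow> 'v set set \<Rightarrow> bool" where
  "maximum_matching V E M \<longleftrightarrow>
     matching V E M \<and> (\<forall>N. matching V E N \<longrightarrow> card N \<le> card M)"


section \<open>The complex points of the versal variety\<close>

text \<open>The vertices covered by the matching \<open>M\<close> are those in \<open>\<Union>M\<close>.\<close>

datatype 'v coord = Coord_x 'v | Coord_x' 'v | Coord_alpha 'v

definition versal_coords :: "'v set \<Rightarrow> 'v set set \<Rightarrow> 'v coord set" where
  "versal_coords V M = Coord_x ` V \<union> Coord_x' ` V \<union> Coord_alpha ` (V - \<Union>M)"

definition versal_alpha :: "'v set set \<Rightarrow> ('v coord \<Rightarrow> complex) \<Rightarrow> 'v \<Rightarrow> complex" where
  "versal_alpha M z i = (if i \<in> \<Union>M then 1 else z (Coord_alpha i))"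

definition versal_equations ::
    "'v set \<Rightarrow> 'v set set \<Rightarrow> 'v set set \<Rightarrow> ('v coord \<Rightarrow> complex) \<Rightarrow> bool" where
  "versal_equations V E M z \<longleftrightarrow>
     (\<forall>i\<in>V. z (Coord_x i) * z (Coord_x' i)
              = 1 + versal_alpha M z i * (\<Prod>j\<in>{j\<in>V. adjacent E i j}. z (Coord_x j))) \<and>
     (\<forall>i\<in>V - \<Union>M. z (Coord_alpha i) \<noteq> 0)"

text \<open>
  The points carry the classical topology, as a subspace of the affine space with coordinates
  \<open>versal_coords V M\<close>; in \<^const>\<open>product_topology\<close>, a point is \<^const>\<open>undefined\<close> off the
  coordinates.
\<close>

definition X_versal ::
    "'v set \<Rightarrow> 'v set set \<Rightarrow> 'v set set \<Rightarrow> ('v coord \<Rightarrow> complex) topology" where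
  "X_versal V E M =
     subtopology (product_topology (\<lambda>_. euclidean) (versal_coords V M))
       {z. versal_equations V E M z}"


section \<open>Euler characteristic\<close>

text \<open>Linear independence over the integers in a (multiplicatively written) abelian group.\<close>

definition int_independent :: "('a, 'b) monoid_scheme \<Rightarrow> 'a set \<Rightarrow> bool" where
  "int_independent G S \<longleftrightarrow>
     S \<subseteq> carrier G \<and>
     (\<forall>F (c :: 'a \<Rightarrow> int). finite F \<and> F \<subseteq> S \<and>
        finprod G (\<lambda>s. s [^]\<^bsub>G\<^esub> c s) F = \<one>\<^bsub>G\<^esub> \<longrightarrow> (\<forall>s\<in>F. c s = 0))"

definition has_rank :: "('a, 'b) monoid_scheme \<Rightarrow> nat \<Rightarrow> bool" where
  "has_rank G n \<longleftrightarrow>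
     (\<exists>S. int_independent G S \<and> finite S \<and> card S = n) \<and>
     (\<forall>S. int_independent G S \<longrightarrow> finite S \<and> card S \<le> n)"

text \<open>
  The alternating sum of the Betti numbers for singular homology. The relation includes that
  all of them are finite and that almost all of them vanish.
\<close>

definition has_euler_characteristic :: "'a topology \<Rightarrow> int \<Rightarrow> bool" where
  "has_euler_characteristic X k \<longleftrightarrow>
     (\<exists>b :: nat \<Rightarrow> nat.
        (\<forall>p. has_rank (homology_group (int p) X) (b p)) \<and>
        finite {p. b p \<noteq> 0} \<and>
        k = (\<Sum>p | b p \<noteq> 0. (- 1) ^ p * int (b p)))"

lemma has_rank_unique:
  assumes "has_rank G m" "has_rank G n"
  shows "m = n"
  using assms unfolding has_rank_def by (metis le_antisym)

lemma has_euler_characteristic_unique: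
  assumes "has_euler_characteristic X a" "has_euler_characteristic X b"
  shows "a = b"
proof -
  obtain f g :: "nat \<Rightarrow> nat" where
    f: "\<And>p. has_rank (homology_group (int p) X) (f p)" "a = (\<Sum>p | f p \<noteq> 0. (- 1) ^ p * int (f p))"
    and g: "\<And>p. has_rank (homology_group (int p) X) (g p)" "b = (\<Sum>p | g p \<noteq> 0. (- 1) ^ p * int (g p))"
    using assms unfolding has_euler_characteristic_def by blast
  have "f = g"
    using has_rank_unique[OF f(1) g(1)] by blast
  then show ?thesis
    using f(2) g(2) by simp
qed

end

theory Submission
  imports Defs
begin

text \<open>
  Write \<open>f\<^sub>i = \<alpha>\<^sub>i \<Prod>\<^sub>j x\<^sub>j\<close>, so that the equations are \<open>x\<^sub>i x'\<^sub>i = 1 + f\<^sub>i\<close>, and stratify the variety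
  by the set \<open>S\<close> of vertices with \<open>x\<^sub>i = 0\<close>. The Euler characteristic is additive along the
  stratification, by Mayer-Vietoris: since a forest with a perfect matching has a unimodular
  adjacency matrix, for each \<open>i\<close> there is an action of \<open>\<complex>\<^sup>*\<close> that scales \<open>f\<^sub>i\<close> and fixes \<open>x\<^sub>i\<close> and the
  other \<open>f\<^sub>k\<close>; it trivializes a neighbourhood of the divisor \<open>x\<^sub>i = 0\<close>, so that the punctured
  neighbourhood is, up to homotopy, the product of a circle and the divisor, and has Euler
  characteristic \<open>0\<close>.

  On the stratum of \<open>S\<close> one has \<open>f\<^sub>i = - 1\<close> for \<open>i \<in> S\<close>, hence \<open>S\<close> is independent. If some vertex
  outside \<open>S\<close> is unmatched, or has its partner outside \<open>S\<close> too, then the same actions split off a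
  factor \<open>\<complex>\<^sup>*\<close> and the stratum contributes \<open>0\<close>. Otherwise the remaining monomial equations have a
  unique solution, the stratum is an affine space and contributes \<open>1\<close>; by Koenig's theorem these \<open>S\<close>
  are the complements of the minimum vertex covers.
\<close>

section \<open>Ranks of abelian groups\<close>

text \<open>For singular homology, additivity along a stratification needs a product neighbourhood
  of what is cut out. So the divisors x_i = 0 are cut one vertex at a time, and the intermediate
  pieces are the sets \<open>stratum A S\<close>, in which only the vertices of A have been decided.
  Unimodularity matters because an action of C^* needs integral exponents; rational ones would give
  multivalued scalings. The neighbourhood is |x_i x'_i| < 1: there f_i = x_i x'_i - 1 cannot vanish,
  so x_j is nonzero for every neighbour j of i, and the action can adjust f_i after x_i and x'_i
  have been changed. A further obstacle is finiteness: \<open>has_euler_characteristic\<close>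
  includes finite Betti numbers, so a factor C^* yields 0 only once the other factor is known to
  have some Euler characteristic. This is why the full strata are treated first without equations,
  and the equations are then imposed one by one, each time passing to a retract.\<close>

lemma (in comm_monoid) finprod_swap:
  assumes "finite A" "finite B" "\<And>a b. a \<in> A \<Longrightarrow> b \<in> B \<Longrightarrow> g a b \<in> carrier G"
  shows "finprod G (\<lambda>a. finprod G (g a) B) A = finprod G (\<lambda>b. finprod G (\<lambda>a. g a b) A) B"
  using assms(1,3)
proof (induction A rule: finite_induct)
  case empty
  then show ?case by simp
next
  case (insert a A)
  have "finprod G (\<lambda>a. finprod G (g a) B) (insert a A)
      = finprod G (g a) B \<otimes> finprod G (\<lambda>a. finprod G (g a) B) A"
    using insert by (subst finprod_insert) (auto intro!: finprod_closed)
  also have "\<dots> = finprod G (g a) B \<otimes> finprod G (\<lambda>b. finprod G (\<lambda>a. g a b) A) B"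
    using insert by simp
  also have "\<dots> = finprod G (\<lambda>b. g a b \<otimes> finprod G (\<lambda>a. g a b) A) B"
    using insert by (subst finprod_multf) (auto intro!: finprod_closed)
  also have "\<dots> = finprod G (\<lambda>b. finprod G (\<lambda>a. g a b) (insert a A)) B"
    using insert by (intro finprod_cong') (auto intro!: finprod_closed)
  finally show ?case .
qed

lemma (in comm_group) finprod_int_pow:
  assumes "s \<in> carrier G" "finite A"
  shows "finprod G (\<lambda>t. s [^] (g t :: int)) A = s [^] (\<Sum>t\<in>A. g t)"
  using assms(2) by (induction A rule: finite_induct) (use assms(1) in \<open>auto simp: int_pow_mult\<close>)

lemma hom_finprod:
  assumes "comm_group G" "comm_group H" "h \<in> hom G H" "g \<in> A \<rightarrow> carrier G"
  shows "h (finprod G g A) = finprod H (\<lambda>a. h (g a)) A"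
proof -
  interpret G: comm_group G by fact
  interpret H: comm_group H by fact
  have hc: "h x \<in> carrier H" if "x \<in> carrier G" for x
    using assms(3) that by (auto simp: hom_def)
  have h1: "h \<one>\<^bsub>G\<^esub> = \<one>\<^bsub>H\<^esub>"
    using assms(3) G.is_group H.is_group hom_one by blast
  show ?thesis
  proof (cases "finite A")
    case True
    then show ?thesis using assms(4)
    proof (induction A rule: finite_induct)
      case empty
      then show ?case by (simp add: h1)
    next
      case (insert a A)
      then have ga: "g a \<in> carrier G" "g \<in> A \<rightarrow> carrier G" by auto
      have "h (g a \<otimes>\<^bsub>G\<^esub> finprod G g A) = h (g a) \<otimes>\<^bsub>H\<^esub> h (finprod G g A)"
        using ga by (intro hom_mult[OF assms(3)]) (auto intro!: G.finprod_closed)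
      moreover have "(\<lambda>a. h (g a)) \<in> A \<rightarrow> carrier H" using ga hc by auto
      ultimately show ?case using insert ga hc by simp
    qed
  next
    case False
    then show ?thesis by (simp add: h1)
  qed
qed

section \<open>Linear combinations and independent families\<close>

definition lincomb :: "('a, 'b) monoid_scheme \<Rightarrow> ('i \<Rightarrow> 'a) \<Rightarrow> ('i \<Rightarrow> int) \<Rightarrow> 'i set \<Rightarrow> 'a" where
  "lincomb G f c S = finprod G (\<lambda>s. f s [^]\<^bsub>G\<^esub> c s) S"

text \<open>Families instead of sets: a homomorphism may identify elements of an independent set,
  and such a coincidence has to count as a relation.\<close>

definition family_independent :: "('a, 'b) monoid_scheme \<Rightarrow> ('i \<Rightarrow> 'a) \<Rightarrow> 'i set \<Rightarrow> bool" where
  "family_independent G f S \<longleftrightarrow>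
     f ` S \<subseteq> carrier G \<and>
     (\<forall>F c. finite F \<and> F \<subseteq> S \<and> lincomb G f c F = \<one>\<^bsub>G\<^esub> \<longrightarrow> (\<forall>s\<in>F. c s = 0))"

lemma int_independent_family: "int_independent G S \<longleftrightarrow> family_independent G id S"
  by (simp add: int_independent_def family_independent_def lincomb_def)

lemma (in comm_group) lincomb_closed [intro]:
  "f ` S \<subseteq> carrier G \<Longrightarrow> lincomb G f c S \<in> carrier G"
  unfolding lincomb_def by (rule finprod_closed) auto

lemma (in comm_group) lincomb_mono_neutral:
  assumes "finite S" "F \<subseteq> S" "f ` S \<subseteq> carrier G" "\<And>s. s \<in> S - F \<Longrightarrow> c s = 0"
  shows "lincomb G f c S = lincomb G f c F"
  unfolding lincomb_def
proof (rule finprod_mono_neutral_cong_right)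
  show "f s [^] c s = \<one>" if "s \<in> S - F" for s
    using assms that by (simp add: int_pow_def2)
  show "(\<lambda>s. f s [^] c s) \<in> S \<rightarrow> carrier G"
    using assms by (auto intro!: int_pow_closed)
qed (use assms in auto)

lemma (in comm_group) family_independent_finite:
  assumes "finite S"
  shows "family_independent G f S \<longleftrightarrow>
     f ` S \<subseteq> carrier G \<and> (\<forall>c. lincomb G f c S = \<one> \<longrightarrow> (\<forall>s\<in>S. c s = 0))"
proof
  assume "family_independent G f S"
  then show "f ` S \<subseteq> carrier G \<and> (\<forall>c. lincomb G f c S = \<one> \<longrightarrow> (\<forall>s\<in>S. c s = 0))"
    using assms unfolding family_independent_def by blast
next
  assume R: "f ` S \<subseteq> carrier G \<and> (\<forall>c. lincomb G f c S = \<one> \<longrightarrow> (\<forall>s\<in>S. c s = 0))"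
  show "family_independent G f S"
    unfolding family_independent_def
  proof (intro conjI allI impI)
    fix F c assume F: "finite F \<and> F \<subseteq> S \<and> lincomb G f c F = \<one>"
    define c' where "c' = (\<lambda>s. if s \<in> F then c s else 0)"
    have "lincomb G f c' S = lincomb G f c' F"
      using F R assms by (intro lincomb_mono_neutral) (auto simp: c'_def)
    also have "\<dots> = lincomb G f c F"
      unfolding lincomb_def using F R by (intro finprod_cong') (auto simp: c'_def subset_iff intro!: int_pow_closed)
    finally have "\<forall>s\<in>S. c' s = 0"
      using R F by auto
    then show "\<forall>s\<in>F. c s = 0"
      using F by (metis c'_def subsetD)
  qed (use R in auto)
qed

lemma lincomb_hom:
  assumes "comm_group G" "comm_group H" "h \<in> hom G H" "f ` S \<subseteq> carrier G"
  shows "h (lincomb G f c S) = lincomb H (h \<circ> f) c S"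
proof -
  interpret G: comm_group G by fact
  interpret H: comm_group H by fact
  have "h (lincomb G f c S) = finprod H (\<lambda>s. h (f s [^]\<^bsub>G\<^esub> c s)) S"
    unfolding lincomb_def using assms(4) by (intro hom_finprod[OF assms(1-3)]) auto
  also have "\<dots> = lincomb H (h \<circ> f) c S"
    unfolding lincomb_def using assms
    by (intro H.finprod_cong')
       (auto simp: hom_int_pow[OF assms(3) _ G.is_group H.is_group] intro!: H.int_pow_closed dest: hom_in_carrier)
  finally show ?thesis .
qed

lemma family_independent_subset:
  assumes "family_independent G f S" "T \<subseteq> S"
  shows "family_independent G f T"
proof -
  have "f ` T \<subseteq> carrier G" using assms unfolding family_independent_def by (meson image_mono subset_trans)
  then show ?thesis using assms unfolding family_independent_def by (metis subset_trans)
qed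

lemma int_independent_subset: "int_independent G S \<Longrightarrow> T \<subseteq> S \<Longrightarrow> int_independent G T"
  unfolding int_independent_family by (rule family_independent_subset)

lemma family_independent_inj_on:
  assumes "comm_group G" "family_independent G f S"
  shows "inj_on f S"
proof (rule inj_onI, rule ccontr)
  interpret comm_group G by fact
  fix s t assume st: "s \<in> S" "t \<in> S" "f s = f t" "s \<noteq> t"
  have car: "f s \<in> carrier G" "f t \<in> carrier G"
    using assms(2) st by (auto simp: family_independent_def)
  \<comment> \<open>Two equal values would satisfy the relation with coefficients 1 and -1.\<close>
  define c :: "_ \<Rightarrow> int" where "c = (\<lambda>u. if u = s then 1 else - 1)"
  have "lincomb G f c {s, t} = \<one>\<^bsub>G\<^esub>"
    using st car by (simp add: lincomb_def c_def int_pow_neg)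
  then have "c s = 0"
    using assms(2) st unfolding family_independent_def
    by (metis empty_subsetI finite.emptyI finite_insert insert_iff insert_subset)
  then show False by (simp add: c_def)
qed

lemma family_independent_image:
  assumes "comm_group G" 
  shows "family_independent G f S \<longleftrightarrow> inj_on f S \<and> int_independent G (f ` S)"
proof -
  interpret comm_group G by fact
  have *: "family_independent G f S \<longleftrightarrow> int_independent G (f ` S)" if inj: "inj_on f S"
  proof -
    have eq: "lincomb G f c F = lincomb G id (c \<circ> inv_into S f) (f ` F)"
      if "F \<subseteq> S" "finite F" "f ` S \<subseteq> carrier G" for c F
      unfolding lincomb_def
    proof (subst finprod_reindex)
      show "(\<lambda>s. id s [^]\<^bsub>G\<^esub> (c \<circ> inv_into S f) s) \<in> f ` F \<rightarrow> carrier G"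
        using that by (auto intro!: int_pow_closed)
      show "inj_on f F" using inj that inj_on_subset by blast
      show "finprod G (\<lambda>s. f s [^]\<^bsub>G\<^esub> c s) F = finprod G (\<lambda>x. id (f x) [^]\<^bsub>G\<^esub> (c \<circ> inv_into S f) (f x)) F"
        using that inj by (intro finprod_cong') (auto intro!: int_pow_closed simp: subset_iff)
    qed
    show ?thesis
    proof
      assume L: "family_independent G f S"
      show "int_independent G (f ` S)"
        unfolding int_independent_family family_independent_def
      proof (intro conjI allI impI)
        fix F c assume F: "finite F \<and> F \<subseteq> f ` S \<and> lincomb G id c F = \<one>\<^bsub>G\<^esub>"
        then obtain F' where F': "F' \<subseteq> S" "F = f ` F'" "finite F'"
          by (meson finite_subset_image)
        have "lincomb G f (c \<circ> f) F' = lincomb G id c F"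
          unfolding lincomb_def F'(2)
        proof (subst finprod_reindex)
          show "(\<lambda>s. id s [^]\<^bsub>G\<^esub> c s) \<in> f ` F' \<rightarrow> carrier G"
            using L F' by (auto simp: family_independent_def intro!: int_pow_closed)
          show "inj_on f F'" using inj F' inj_on_subset by blast
        qed auto
        then have "\<forall>s\<in>F'. (c \<circ> f) s = 0"
          using L F F' unfolding family_independent_def by metis
        then show "\<forall>s\<in>F. c s = 0" using F' by auto
      qed (use L in \<open>auto simp: family_independent_def\<close>)
    next
      assume R: "int_independent G (f ` S)"
      then have car: "f ` S \<subseteq> carrier G" by (simp add: int_independent_def)
      show "family_independent G f S"
        unfolding family_independent_def
      proof (intro conjI allI impI car)
        fix F c assume F: "finite F \<and> F \<subseteq> S \<and> lincomb G f c F = \<one>\<^bsub>G\<^esub>"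
        then have "lincomb G id (c \<circ> inv_into S f) (f ` F) = \<one>\<^bsub>G\<^esub>" using eq car by metis
        moreover have "finite (f ` F)" "f ` F \<subseteq> f ` S" using F by auto
        ultimately have "\<forall>s\<in>f ` F. (c \<circ> inv_into S f) s = 0"
          using R unfolding int_independent_family family_independent_def by metis
        then show "\<forall>s\<in>F. c s = 0"
          using F inj by (auto simp: subset_iff)
      qed
    qed
  qed
  then show ?thesis using family_independent_inj_on[OF assms] by metis
qed

text \<open>In use, \<open>K\<close> is a kernel or an image. Independence refers only to the
  ambient group, so no subgroup structure has to be formed.\<close>

definition rank_on :: "('a, 'b) monoid_scheme \<Rightarrow> 'a set \<Rightarrow> nat \<Rightarrow> bool" where
  "rank_on G K n \<longleftrightarrow>
     (\<exists>S\<subseteq>K. int_independent G S \<and> finite S \<and> card S = n) \<and>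
     (\<forall>S\<subseteq>K. int_independent G S \<longrightarrow> finite S \<and> card S \<le> n)"

lemma has_rank_rank_on: "has_rank G n \<longleftrightarrow> rank_on G (carrier G) n"
  unfolding has_rank_def rank_on_def by (metis int_independent_def)

lemma rank_onD:
  assumes "rank_on G K n" "S \<subseteq> K" "int_independent G S"
  shows "finite S" "card S \<le> n"
  using assms unfolding rank_on_def by simp_all

lemma rank_on_unique: "rank_on G K m \<Longrightarrow> rank_on G K n \<Longrightarrow> m = n"
  unfolding rank_on_def by (metis le_antisym)

text \<open>The empty set is independent and cardinalities are bounded, so a greatest one exists. An
  infinite independent set would contain an independent set with \<open>Suc n\<close>
  elements.\<close>

lemma rank_on_exists:
  assumes "\<And>S. S \<subseteq> K \<Longrightarrow> finite S \<Longrightarrow> int_independent G S \<Longrightarrow> card S \<le> n"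
  obtains m where "m \<le> n" "rank_on G K m"
proof -
  define P where "P m \<longleftrightarrow> (\<exists>S\<subseteq>K. int_independent G S \<and> finite S \<and> card S = m)" for m
  have "P 0"
    unfolding P_def by (rule exI[of _ "{}"]) (auto simp: int_independent_def)
  moreover have bound: "m \<le> n" if "P m" for m
    using that assms unfolding P_def by auto
  ultimately have G: "P (Greatest P)" "\<And>m. P m \<Longrightarrow> m \<le> Greatest P"
    by (metis GreatestI_nat, metis Greatest_le_nat)
  have "rank_on G K (Greatest P)"
    unfolding rank_on_def
  proof (intro conjI allI impI)
    show "\<exists>S\<subseteq>K. int_independent G S \<and> finite S \<and> card S = Greatest P"
      using G(1) unfolding P_def .
    fix S assume S: "S \<subseteq> K" "int_independent G S"
    show fin: "finite S"
    proof (rule ccontr)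
      assume "infinite S"
      then obtain T where "T \<subseteq> S" "finite T" "card T = Suc n"
        using infinite_arbitrarily_large by blast
      then show False
        using assms[of T] int_independent_subset[OF S(2)] subset_trans[OF _ S(1)] by simp
    qed
    show "card S \<le> Greatest P"
      using S fin by (intro G(2)) (auto simp: P_def)
  qed
  then show ?thesis by (intro that[OF bound[OF G(1)]])
qed

text \<open>
  With \<open>U \<subseteq> T\<close> maximal such that \<open>f\<close> keeps it independent, each \<open>t \<in> T - U\<close> yields a relation in the
  image, hence an element \<open>u t\<close> of the kernel; these elements are independent.
\<close>

lemma rank_nullity_upper:
  assumes G: "comm_group G" and H: "comm_group H" and f: "f \<in> hom G H"
    and k: "\<And>S. S \<subseteq> kernel G H f \<Longrightarrow> finite S \<Longrightarrow> int_independent G S \<Longrightarrow> card S \<le> k"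
    and r: "\<And>S. S \<subseteq> f ` carrier G \<Longrightarrow> finite S \<Longrightarrow> int_independent H S \<Longrightarrow> card S \<le> r"
    and T: "finite T" "int_independent G T"
  shows "card T \<le> k + r"
proof -
  interpret G: comm_group G by fact
  interpret H: comm_group H by fact
  have Tcar: "T \<subseteq> carrier G" using T by (simp add: int_independent_def)
  have fcar: "f x \<in> carrier H" if "x \<in> carrier G" for x
    using f that by (rule hom_in_carrier)
  define P where "P U \<longleftrightarrow> U \<subseteq> T \<and> family_independent H f U" for U
  have "P {}" by (auto simp: P_def family_independent_def)
  moreover have "card U \<le> card T" if "P U" for U
    using that T by (simp add: P_def card_mono)
  ultimately obtain U where U: "P U" "\<And>U'. P U' \<Longrightarrow> card U' \<le> card U"
    using ex_has_greatest_nat[of P "{}" card "Suc (card T)"] by (metis less_Suc_eq_le)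
  have finU: "finite U" and UT: "U \<subseteq> T" using U T finite_subset by (auto simp: P_def)
  have "\<exists>d. d t \<noteq> 0 \<and> (\<forall>s. s \<notin> insert t U \<longrightarrow> d s = 0) \<and> lincomb H f d T = \<one>\<^bsub>H\<^esub>" if t: "t \<in> T - U" for t
  proof -
    have fi: "finite (insert t U)" "insert t U \<subseteq> T" using finU UT t by auto
    have "\<not> P (insert t U)"
      using U(2)[of "insert t U"] t finU by auto
    then have "\<not> family_independent H f (insert t U)"
      using t UT by (auto simp: P_def)
    moreover have fim: "f ` insert t U \<subseteq> carrier H" using fi Tcar fcar by auto
    ultimately obtain c where c: "lincomb H f c (insert t U) = \<one>\<^bsub>H\<^esub>" "\<exists>s\<in>insert t U. c s \<noteq> 0"
      using H.family_independent_finite[OF fi(1), of f] fim by auto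
    define d where "d = (\<lambda>s. if s \<in> insert t U then c s else 0)"
    have im: "f ` T \<subseteq> carrier H" using Tcar fcar by auto
    have "lincomb H f d T = lincomb H f d (insert t U)"
      using T fi im by (intro H.lincomb_mono_neutral) (auto simp: d_def)
    also have "\<dots> = lincomb H f c (insert t U)"
      unfolding lincomb_def using fi im by (intro H.finprod_cong') (auto simp: d_def intro!: H.int_pow_closed)
    finally have "lincomb H f d T = \<one>\<^bsub>H\<^esub>" using c by simp
    \<comment> \<open>Otherwise the relation would involve \<open>U\<close> only, where
      \<open>f\<close> is independent.\<close>
    moreover have "d t \<noteq> 0"
    proof
      assume "d t = 0"
      then have "c t = 0" by (simp add: d_def)
      then have "lincomb H f c (insert t U) = lincomb H f c U"
        using fi im by (intro H.lincomb_mono_neutral) auto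
      then have "\<forall>s\<in>U. c s = 0"
        using U(1) c(1) H.family_independent_finite[OF finU, of f] by (auto simp: P_def)
      then show False using c(2) \<open>c t = 0\<close> by auto
    qed
    ultimately show ?thesis by (intro exI[of _ d]) (auto simp: d_def)
  qed
  then obtain d where d: "\<And>t. t \<in> T - U \<Longrightarrow> d t t \<noteq> 0"
      "\<And>t s. t \<in> T - U \<Longrightarrow> s \<notin> insert t U \<Longrightarrow> d t s = (0::int)"
      "\<And>t. t \<in> T - U \<Longrightarrow> lincomb H f (d t) T = \<one>\<^bsub>H\<^esub>"
    by metis
  define u where "u t = lincomb G id (d t) T" for t
  have ucar: "u t \<in> carrier G" for t
    unfolding u_def using Tcar by (intro G.lincomb_closed) auto
  have uker: "u t \<in> kernel G H f" if "t \<in> T - U" for t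
  proof -
    have "f (u t) = lincomb H (f \<circ> id) (d t) T"
      unfolding u_def using Tcar by (intro lincomb_hom[OF G H f]) auto
    then show ?thesis using d(3)[OF that] ucar by (simp add: kernel_def)
  qed
  have finTU: "finite (T - U)" using T by auto
  \<comment> \<open>After exchanging the products, a relation among the \<open>u t\<close> becomes
    one among the elements of \<open>T\<close>. Since \<open>d t\<close> vanishes outside
    \<open>insert t U\<close>, its coefficient at \<open>s\<close> in \<open>T - U\<close> is just
    \<open>d s s * e s\<close>, with \<open>d s s\<close> nonzero.\<close>
  have "family_independent G u (T - U)"
    unfolding G.family_independent_finite[OF finTU]
  proof (intro conjI allI impI ballI)
    show "u ` (T - U) \<subseteq> carrier G" using ucar by auto
    fix e s assume e: "lincomb G u e (T - U) = \<one>\<^bsub>G\<^esub>" and s: "s \<in> T - U"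
    have "lincomb G u e (T - U)
        = finprod G (\<lambda>t. finprod G (\<lambda>s. s [^]\<^bsub>G\<^esub> (d t s * e t)) T) (T - U)"
      unfolding lincomb_def
    proof (rule G.finprod_cong')
      fix t assume t: "t \<in> T - U"
      have pw: "(\<lambda>x. x [^]\<^bsub>G\<^esub> n) \<in> hom G G" for n :: int
        by (rule homI) (auto simp: G.int_pow_distrib)
      have "u t [^]\<^bsub>G\<^esub> e t = finprod G (\<lambda>s. (s [^]\<^bsub>G\<^esub> d t s) [^]\<^bsub>G\<^esub> e t) T"
        unfolding u_def lincomb_def id_def using Tcar by (intro hom_finprod[OF G G pw]) auto
      also have "\<dots> = finprod G (\<lambda>s. s [^]\<^bsub>G\<^esub> (d t s * e t)) T"
        using Tcar by (intro G.finprod_cong') (auto simp: G.int_pow_pow)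
      finally show "u t [^]\<^bsub>G\<^esub> e t = finprod G (\<lambda>s. s [^]\<^bsub>G\<^esub> (d t s * e t)) T" .
    qed (use Tcar in \<open>auto intro!: G.finprod_closed G.int_pow_closed\<close>)
    also have "\<dots> = finprod G (\<lambda>s. finprod G (\<lambda>t. s [^]\<^bsub>G\<^esub> (d t s * e t)) (T - U)) T"
      using Tcar T by (intro G.finprod_swap) auto
    also have "\<dots> = finprod G (\<lambda>s. s [^]\<^bsub>G\<^esub> (\<Sum>t\<in>T - U. d t s * e t)) T"
    proof (rule G.finprod_cong')
      fix s assume "s \<in> T"
      then have scar: "s \<in> carrier G" using Tcar by auto
      show "finprod G (\<lambda>t. s [^]\<^bsub>G\<^esub> (d t s * e t)) (T - U) = s [^]\<^bsub>G\<^esub> (\<Sum>t\<in>T - U. d t s * e t)"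
        using scar finTU by (rule G.finprod_int_pow)
    qed (use Tcar in \<open>auto intro!: G.finprod_closed G.int_pow_closed\<close>)
    also have "\<dots> = lincomb G id (\<lambda>s. \<Sum>t\<in>T - U. d t s * e t) T"
      by (simp add: lincomb_def)
    finally have "lincomb G id (\<lambda>s. \<Sum>t\<in>T - U. d t s * e t) T = \<one>\<^bsub>G\<^esub>" using e by simp
    then have "\<forall>s\<in>T. (\<Sum>t\<in>T - U. d t s * e t) = 0"
      by (rule T(2)[unfolded int_independent_family G.family_independent_finite[OF T(1)], THEN conjunct2,
          THEN spec, THEN mp])
    then have "(\<Sum>t\<in>T - U. d t s * e t) = 0" using s by auto
    moreover have "(\<Sum>t\<in>T - U. d t s * e t) = (\<Sum>t\<in>{s}. d t s * e t)"
      using finTU s d(2) by (intro sum.mono_neutral_right) auto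
    ultimately show "e s = 0" using d(1)[OF s] by simp
  qed
  then have "inj_on u (T - U)" "int_independent G (u ` (T - U))"
    by (simp_all add: family_independent_image[OF G])
  then have "card (T - U) \<le> k"
    using k[of "u ` (T - U)"] uker finTU by (auto simp: card_image)
  moreover have "inj_on f U" "int_independent H (f ` U)"
    using U(1) by (simp_all add: P_def family_independent_image[OF H])
  then have "card U \<le> r"
    using r[of "f ` U"] finU UT Tcar by (auto simp: card_image)
  moreover have "card T = card (T - U) + card U"
    using T UT finU by (simp add: card_Diff_subset card_mono)
  ultimately show ?thesis by simp
qed

text \<open>Applying \<open>f\<close> to a relation on the union kills the part in the kernel and
  leaves a relation of the family \<open>f\<close> on \<open>R\<close>. Hence the coefficients on
  \<open>R\<close> vanish, and a relation on \<open>S\<close> alone remains.\<close>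

lemma family_independent_lift:
  assumes G: "comm_group G" and H: "comm_group H" and f: "f \<in> hom G H"
    and S: "int_independent G S" "S \<subseteq> kernel G H f" "finite S"
    and R: "family_independent H f R" "R \<subseteq> carrier G" "finite R"
  shows "int_independent G (S \<union> R)" "S \<inter> R = {}"
proof -
  interpret G: comm_group G by fact
  interpret H: comm_group H by fact
  have car: "S \<union> R \<subseteq> carrier G" using S R by (auto simp: int_independent_def)
  have fcar: "f x \<in> carrier H" if "x \<in> carrier G" for x
    using f that by (rule hom_in_carrier)
  show disj: "S \<inter> R = {}"
  proof (rule ccontr)
    assume "S \<inter> R \<noteq> {}"
    then obtain x where x: "x \<in> S" "x \<in> R" by auto
    then have "f x = \<one>\<^bsub>H\<^esub>" using S by (auto simp: kernel_def)
    then have "lincomb H f (\<lambda>_. 1) {x} = \<one>\<^bsub>H\<^esub>" by (simp add: lincomb_def)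
    then show False using R(1) x unfolding family_independent_def
      by (metis bot.extremum finite.emptyI finite_insert insertI1 insert_subset one_neq_zero)
  qed
  show "int_independent G (S \<union> R)"
    unfolding int_independent_family G.family_independent_finite[OF finite_UnI[OF S(3) R(3)]]
  proof (intro conjI allI impI)
    show "id ` (S \<union> R) \<subseteq> carrier G" using car by simp
    fix c assume c: "lincomb G id c (S \<union> R) = \<one>\<^bsub>G\<^esub>"
    have split: "lincomb G id c (S \<union> R) = lincomb G id c S \<otimes>\<^bsub>G\<^esub> lincomb G id c R"
      unfolding lincomb_def using car disj S R by (intro G.finprod_Un_disjoint) auto
    have "lincomb H (f \<circ> id) c (S \<union> R) = f \<one>\<^bsub>G\<^esub>"
      using lincomb_hom[OF G H f, of id "S \<union> R" c] c car by simp
    also have "\<dots> = \<one>\<^bsub>H\<^esub>" using f G.is_group H.is_group hom_one by blast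
    finally have "lincomb H f c (S \<union> R) = \<one>\<^bsub>H\<^esub>" by simp
    moreover have "lincomb H f c (S \<union> R) = lincomb H f c R"
      unfolding lincomb_def
    proof (rule H.finprod_mono_neutral_cong_right)
      show "f s [^]\<^bsub>H\<^esub> c s = \<one>\<^bsub>H\<^esub>" if "s \<in> (S \<union> R) - R" for s
        using that S by (auto simp: kernel_def)
    qed (use S R car fcar in \<open>auto intro!: H.int_pow_closed\<close>)
    ultimately have cR: "\<forall>s\<in>R. c s = 0"
      using R unfolding H.family_independent_finite[OF R(3)] by auto
    have "lincomb G id c (S \<union> R) = lincomb G id c S"
      using S R car cR by (intro G.lincomb_mono_neutral) auto
    then have "\<forall>s\<in>S. c s = 0"
      using S c unfolding int_independent_family G.family_independent_finite[OF S(3)] by auto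
    then show "\<forall>s\<in>S \<union> R. c s = 0" using cR by auto
  qed
qed

text \<open>The bound of \<open>rank_nullity_upper\<close> is attained by a maximal independent set
  of the kernel together with lifts of one of the image.\<close>

lemma rank_nullity:
  assumes G: "comm_group G" and H: "comm_group H" and f: "f \<in> hom G H"
    and k: "rank_on G (kernel G H f) k" and r: "rank_on H (f ` carrier G) r"
  shows "has_rank G (k + r)"
proof -
  have up: "card T \<le> k + r" if "finite T" "int_independent G T" for T
  proof (rule rank_nullity_upper[OF G H f _ _ that])
    show "card S \<le> k" if "S \<subseteq> kernel G H f" "int_independent G S" for S
      using rank_onD(2)[OF k that] .
    show "card S \<le> r" if "S \<subseteq> f ` carrier G" "int_independent H S" for S
      using rank_onD(2)[OF r that] .
  qed
  obtain S where S: "S \<subseteq> kernel G H f" "int_independent G S" "finite S" "card S = k"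
    using k unfolding rank_on_def by blast
  obtain R' where R': "R' \<subseteq> f ` carrier G" "int_independent H R'" "finite R'" "card R' = r"
    using r unfolding rank_on_def by blast
  then obtain R where R: "R \<subseteq> carrier G" "R' = f ` R" "inj_on f R"
    by (metis subset_image_inj)
  then have R2: "family_independent H f R" "finite R" "card R = r"
    using R' by (simp_all add: family_independent_image[OF H] finite_image_iff card_image)
  note L = family_independent_lift[OF G H f S(2,1,3) R2(1) R(1) R2(2)]
  have "card (S \<union> R) = k + r"
    using L S R2 by (simp add: card_Un_disjoint)
  moreover obtain m where m: "m \<le> k + r" "rank_on G (carrier G) m"
    using rank_on_exists[of "carrier G" G "k + r", OF up] .
  moreover have "S \<union> R \<subseteq> carrier G" using L by (simp add: int_independent_def)
  ultimately have "k + r \<le> m"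
    using rank_onD(2)[OF m(2) _ L(1)] by simp
  then have "m = k + r" using m(1) by (rule antisym[rotated])
  then show ?thesis using m(2) by (simp add: has_rank_rank_on)
qed

section \<open>Ranks of subsets, images and isomorphic groups\<close>

lemma rank_on_subset:
  assumes "rank_on G K n" "L \<subseteq> K"
  obtains m where "m \<le> n" "rank_on G L m"
proof (rule rank_on_exists[of L G n])
  fix S assume "S \<subseteq> L" "int_independent G S"
  then show "card S \<le> n"
    using rank_onD(2)[OF assms(1)] assms(2) by blast
qed (rule that)

text \<open>An independent set in the image lifts to an independent set of the same size: this is
  \<open>family_independent_lift\<close> with an empty kernel part.\<close>

lemma rank_on_image:
  assumes G: "comm_group G" and H: "comm_group H" and f: "f \<in> hom G H" and n: "has_rank G n"
  obtains m where "m \<le> n" "rank_on H (f ` carrier G) m"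
proof (rule rank_on_exists[of "f ` carrier G" H n])
  fix S assume S: "S \<subseteq> f ` carrier G" "finite S" "int_independent H S"
  then obtain R where R: "R \<subseteq> carrier G" "S = f ` R" "inj_on f R"
    by (metis subset_image_inj)
  then have R2: "family_independent H f R" "finite R" "card R = card S"
    using S by (simp_all add: family_independent_image[OF H] finite_image_iff card_image)
  have "int_independent G ({} \<union> R)"
    using R R2 by (intro family_independent_lift(1)[OF G H f]) (auto simp: int_independent_def)
  then have "card R \<le> n"
    using n unfolding has_rank_def by simp
  then show "card S \<le> n"
    using R2 by simp
qed (rule that)

lemma one_notin_int_independent:
  assumes "comm_group G" "int_independent G S"
  shows "\<one>\<^bsub>G\<^esub> \<notin> S"
proof
  assume "\<one>\<^bsub>G\<^esub> \<in> S"
  moreover have "finprod G (\<lambda>s. s [^]\<^bsub>G\<^esub> (1::int)) {\<one>\<^bsub>G\<^esub>} = \<one>\<^bsub>G\<^esub>"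
  proof -
    interpret comm_group G by fact
    show ?thesis by simp
  qed
  ultimately show False
    using assms(2)[unfolded int_independent_def, THEN conjunct2, rule_format, of "{\<one>\<^bsub>G\<^esub>}" "\<lambda>_. 1"] by simp
qed

lemma rank_on_trivial:
  assumes "comm_group G" "K \<subseteq> {\<one>\<^bsub>G\<^esub>}"
  shows "rank_on G K 0"
proof -
  have ind: "int_independent G {}"
    by (auto simp: int_independent_def)
  show ?thesis
    unfolding rank_on_def
  proof (intro conjI allI impI)
    show "\<exists>S\<subseteq>K. int_independent G S \<and> finite S \<and> card S = 0"
      by (rule exI[of _ "{}"]) (simp add: ind)
    fix S assume S: "S \<subseteq> K" "int_independent G S"
    then have "S = {}"
      using assms(2) one_notin_int_independent[OF assms(1) S(2)] by blast
    then show "finite S" "card S \<le> 0" by simp_all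
  qed
qed

lemma has_rank_iso:
  assumes "comm_group G" "comm_group H" "G \<cong> H" "has_rank G n"
  shows "has_rank H n"
proof -
  interpret H: comm_group H by fact
  interpret G: comm_group G by fact
  obtain h where h: "h \<in> iso H G"
    using G.iso_sym[OF assms(3)] by (auto simp: is_iso_def)
  then have hh: "h \<in> hom H G" "inj_on h (carrier H)" "h ` carrier H = carrier G"
    by (auto simp: iso_def bij_betw_def)
  have "kernel H G h = {\<one>\<^bsub>H\<^esub>}"
  proof -
    have one: "h \<one>\<^bsub>H\<^esub> = \<one>\<^bsub>G\<^esub>"
      using hom_one[OF hh(1) H.is_group G.is_group] .
    then have "x = \<one>\<^bsub>H\<^esub>" if "x \<in> carrier H" "h x = \<one>\<^bsub>G\<^esub>" for x
      using inj_onD[OF hh(2), of x "\<one>\<^bsub>H\<^esub>"] that by simp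
    then show ?thesis using one by (auto simp: kernel_def)
  qed
  moreover have "rank_on H {\<one>\<^bsub>H\<^esub>} 0"
    using assms(2) by (rule rank_on_trivial) simp
  ultimately show ?thesis
    using rank_nullity[OF assms(2,1) hh(1), of 0 n] assms(4) hh(3) by (simp add: has_rank_rank_on)
qed

lemma has_rank_trivial:
  assumes "trivial_group G"
  shows "has_rank G 0"
proof -
  interpret group G using assms by (simp add: trivial_group_def)
  have c: "carrier G = {\<one>\<^bsub>G\<^esub>}" using assms by (simp add: trivial_group_def)
  have "comm_group G" by unfold_locales (simp add: c)
  then show ?thesis
    unfolding has_rank_rank_on using c by (intro rank_on_trivial) auto
qed

section \<open>Additivity of the Euler characteristic\<close>

text \<open>Serves to show that a finite rank exists in the middle. Its value is found afterwards by
  counting along the whole sequence.\<close>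

lemma exact_middle_rank:
  assumes "comm_group A" "comm_group B" "comm_group C" "f \<in> hom A B" "g \<in> hom B C"
    and ex: "kernel B C g = f ` carrier A"
    and "has_rank A a" "has_rank C c"
  obtains b where "b \<le> a + c" "has_rank B b"
proof -
  obtain i where i: "i \<le> a" "rank_on B (f ` carrier A) i"
    by (rule rank_on_image[OF assms(1,2,4,7)])
  have "g ` carrier B \<subseteq> carrier C" using assms(5) by (auto simp: hom_def)
  then obtain j where j: "j \<le> c" "rank_on C (g ` carrier B) j"
    using rank_on_subset assms(8) unfolding has_rank_rank_on by metis
  have "has_rank B (i + j)"
    by (rule rank_nullity[OF assms(2,3,5)]) (use i j ex in simp_all)
  moreover have "i + j \<le> a + c" using i j by simp
  ultimately show ?thesis using that by blast
qed

definition ec_pair :: "'a topology \<Rightarrow> 'a set \<Rightarrow> int \<Rightarrow> bool" where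
  "ec_pair X S k \<longleftrightarrow>
     (\<exists>b :: nat \<Rightarrow> nat.
        (\<forall>p. has_rank (relative_homology_group (int p) X S) (b p)) \<and>
        finite {p. b p \<noteq> 0} \<and>
        k = (\<Sum>p | b p \<noteq> 0. (- 1) ^ p * int (b p)))"

lemma ec_pair_empty: "ec_pair X {} k \<longleftrightarrow> has_euler_characteristic X k"
  unfolding ec_pair_def has_euler_characteristic_def ..

text \<open>In the application \<open>a\<close>, \<open>x\<close>, \<open>r\<close> are the Betti
  numbers of a subspace, the space and the pair, and \<open>i\<close>, \<open>g\<close>,
  \<open>d\<close> are the ranks of the inclusion, of the map to the pair and of the boundary map.
  The truncated sums differ by a single term \<open>d n\<close>, which vanishes for large
  \<open>n\<close>. The disjunction \<open>fxr\<close> serves both applications: either the space or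
  the pair may be the unknown one.\<close>

lemma alternating_sum_exact:
  fixes a x r i g d :: "nat \<Rightarrow> nat"
  assumes x: "\<And>p. x p = i p + g p" and r: "\<And>p. r p = g p + d p"
    and a: "\<And>p. a p = d (Suc p) + i p" and d0: "d 0 = 0"
    and fa: "finite {p. a p \<noteq> 0}" and fxr: "finite {p. x p \<noteq> 0} \<or> finite {p. r p \<noteq> 0}"
  shows "finite {p. x p \<noteq> 0}" "finite {p. r p \<noteq> 0}"
    "(\<Sum>p | x p \<noteq> 0. (- 1) ^ p * int (x p))
      = (\<Sum>p | a p \<noteq> 0. (- 1) ^ p * int (a p)) + (\<Sum>p | r p \<noteq> 0. (- 1) ^ p * int (r p))"
proof -
  have fi: "finite {p. i p \<noteq> 0}" by (rule finite_subset[OF _ fa]) (auto simp: a)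
  have "finite (Suc ` {p. a p \<noteq> 0})" using fa by simp
  then have fd: "finite {p. d p \<noteq> 0}"
    by (rule rev_finite_subset) (use d0 a in \<open>auto simp: image_iff gr0_conv_Suc, metis add_gr_0 gr0_conv_Suc neq0_conv old.nat.exhaust\<close>)
  have fg: "finite {p. g p \<noteq> 0}"
    using fxr by (elim disjE; elim rev_finite_subset) (auto simp: x r)
  show fx: "finite {p. x p \<noteq> 0}" by (rule finite_subset[OF _ finite_UnI[OF fi fg]]) (auto simp: x)
  show fr: "finite {p. r p \<noteq> 0}" by (rule finite_subset[OF _ finite_UnI[OF fd fg]]) (auto simp: r)
  obtain N where N: "{p. x p \<noteq> 0} \<union> {p. r p \<noteq> 0} \<union> {p. a p \<noteq> 0} \<union> {p. d p \<noteq> 0} \<subseteq> {..<N}"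
    using finite_nat_bounded[of "{p. x p \<noteq> 0} \<union> {p. r p \<noteq> 0} \<union> {p. a p \<noteq> 0} \<union> {p. d p \<noteq> 0}"] fx fr fa fd by auto
  have *: "(\<Sum>p | b p \<noteq> 0. (- 1) ^ p * int (b p)) = (\<Sum>p<N. (- 1) ^ p * int (b p))"
    if "{p. b p \<noteq> 0} \<subseteq> {..<N}" for b :: "nat \<Rightarrow> nat"
    using that by (intro sum.mono_neutral_left) auto
  have "(\<Sum>p<n. (- 1) ^ p * int (x p))
      = (\<Sum>p<n. (- 1) ^ p * int (a p)) + (\<Sum>p<n. (- 1) ^ p * int (r p)) + (- 1) ^ n * int (d n)" for n
    by (induction n) (auto simp: d0 x r a algebra_simps)
  moreover have "d N = 0" using N by blast
  ultimately show "(\<Sum>p | x p \<noteq> 0. (- 1) ^ p * int (x p))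
      = (\<Sum>p | a p \<noteq> 0. (- 1) ^ p * int (a p)) + (\<Sum>p | r p \<noteq> 0. (- 1) ^ p * int (r p))"
    using N by (simp only: * Un_subset_iff)
qed

lemma long_exact_ranks:
  fixes X :: "'a topology" and a x r :: "nat \<Rightarrow> nat"
  assumes a: "\<And>p. has_rank (homology_group (int p) (subtopology X S)) (a p)"
    and x: "\<And>p. has_rank (homology_group (int p) X) (x p)"
    and r: "\<And>p. has_rank (relative_homology_group (int p) X S) (r p)"
  shows "\<exists>i g d :: nat \<Rightarrow> nat. (\<forall>p. x p = i p + g p) \<and> (\<forall>p. r p = g p + d p) \<and>
    (\<forall>p. a p = d (Suc p) + i p) \<and> d 0 = 0"
proof -
  let ?A = "\<lambda>p. homology_group p (subtopology X S)"
  let ?X = "\<lambda>p. homology_group p X"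
  let ?R = "\<lambda>p. relative_homology_group p X S"
  let ?i = "\<lambda>p. hom_induced p (subtopology X S) {} X {} id"
  let ?j = "\<lambda>p. hom_induced p X {} X S id"
  let ?d = "\<lambda>p. hom_boundary p X S"
  have cg: "comm_group (?A p)" "comm_group (?X p)" "comm_group (?R p)" for p
    by simp_all
  have hom: "?i p \<in> hom (?A p) (?X p)" "?j p \<in> hom (?X p) (?R p)" "?d p \<in> hom (?R p) (?A (p - 1))" for p
    by (simp_all add: hom_induced_hom hom_boundary_hom)
  have kd: "kernel (?R p) (?A (p - 1)) (?d p) = ?j p ` carrier (?X p)" for p
    using homology_exactness_axiom_1[of p X S] by simp
  have ki: "kernel (?A (p - 1)) (?X (p - 1)) (?i (p - 1)) = ?d p ` carrier (?R p)" for p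
    using homology_exactness_axiom_2[of p X S] by simp
  have kj: "kernel (?X p) (?R p) (?j p) = ?i p ` carrier (?A p)" for p
    using homology_exactness_axiom_3[of p X S] by simp
  have "\<exists>m. rank_on (?X (int p)) (?i (int p) ` carrier (?A (int p))) m" for p
    by (rule rank_on_image[OF cg(1,2) hom(1) a]) blast
  then obtain i where i: "\<And>p. rank_on (?X (int p)) (?i (int p) ` carrier (?A (int p))) (i p)"
    by metis
  have "\<exists>m. rank_on (?R (int p)) (?j (int p) ` carrier (?X (int p))) m" for p
    by (rule rank_on_image[OF cg(2,3) hom(2) x]) blast
  then obtain g where g: "\<And>p. rank_on (?R (int p)) (?j (int p) ` carrier (?X (int p))) (g p)"
    by metis
  have "\<exists>m. rank_on (?A (int p - 1)) (?d (int p) ` carrier (?R (int p))) m" for p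
    by (rule rank_on_image[OF cg(3,1) hom(3) r]) blast
  then obtain d where d: "\<And>p. rank_on (?A (int p - 1)) (?d (int p) ` carrier (?R (int p))) (d p)"
    by metis
  show ?thesis
  proof (rule exI[of _ i], rule exI[of _ g], rule exI[of _ d], intro conjI allI)
    show "x p = i p + g p" for p
      using rank_nullity[OF cg(2,3) hom(2), of "int p" "i p" "g p"] i g x has_rank_unique kj by metis
    show "r p = g p + d p" for p
      using rank_nullity[OF cg(3,1) hom(3), of "int p" "g p" "d p"] d g r has_rank_unique kd by metis
    show "a p = d (Suc p) + i p" for p
    proof -
      have "rank_on (?A (int p)) (kernel (?A (int p)) (?X (int p)) (?i (int p))) (d (Suc p))"
        using d[of "Suc p"] ki[of "int (Suc p)"] by simp
      then have "has_rank (?A (int p)) (d (Suc p) + i p)"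
        by (rule rank_nullity[OF cg(1,2) hom(1)]) (rule i)
      then show ?thesis using has_rank_unique a by metis
    qed
    \<comment> \<open>The boundary map out of degree 0 lands in homology of degree -1, which is
      trivial.\<close>
    show "d 0 = 0"
    proof -
      have t: "trivial_group (?A (int 0 - 1))" by simp
      have "?d (int 0) ` carrier (?R (int 0)) \<subseteq> {\<one>\<^bsub>?A (int 0 - 1)\<^esub>}"
        using hom_in_carrier[OF hom(3)[of "int 0"]] t unfolding trivial_group_def by fastforce
      from rank_on_trivial[OF cg(1) this] d[of 0] show ?thesis
        using rank_on_unique by blast
    qed
  qed
qed

lemma ec_pair_relative:
  assumes A: "has_euler_characteristic (subtopology X S) k" and X: "has_euler_characteristic X l"
  shows "ec_pair X S (l - k)"
proof -
  obtain a :: "nat \<Rightarrow> nat" where a: "\<And>p. has_rank (homology_group (int p) (subtopology X S)) (a p)"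
     "finite {p. a p \<noteq> 0}" "k = (\<Sum>p | a p \<noteq> 0. (- 1) ^ p * int (a p))"
    using A unfolding has_euler_characteristic_def by blast
  obtain x :: "nat \<Rightarrow> nat" where x: "\<And>p. has_rank (homology_group (int p) X) (x p)"
     "finite {p. x p \<noteq> 0}" "l = (\<Sum>p | x p \<noteq> 0. (- 1) ^ p * int (x p))"
    using X unfolding has_euler_characteristic_def by blast
  have "\<exists>m. has_rank (relative_homology_group (int p) X S) m" for p
  proof -
    have "\<exists>c. has_rank (homology_group (int p - 1) (subtopology X S)) c"
    proof (cases p)
      case 0
      then show ?thesis by (intro exI[of _ 0] has_rank_trivial) simp
    next
      case (Suc q)
      then show ?thesis using a(1)[of q] by auto
    qed
    then obtain c where c: "has_rank (homology_group (int p - 1) (subtopology X S)) c" ..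
    show ?thesis
      by (rule exact_middle_rank[OF _ _ _ _ _ _ x(1) c, where f = "hom_induced (int p) X {} X S id" and g = "hom_boundary (int p) X S"])
         (use homology_exactness_axiom_1[of "int p" X S] in \<open>auto simp: hom_induced_hom hom_boundary_hom\<close>)
  qed
  then obtain r where r: "\<And>p. has_rank (relative_homology_group (int p) X S) (r p)" by metis
  obtain i g d where *: "\<And>p. x p = i p + g p" "\<And>p. r p = g p + d p"
    "\<And>p. a p = d (Suc p) + i p" "d 0 = 0"
    using long_exact_ranks[OF a(1) x(1) r] by auto
  note ** = alternating_sum_exact[of x i g r d a, OF *(1,2,3,4) a(2) disjI1[OF x(2)]]
  show ?thesis
    unfolding ec_pair_def
  proof (intro exI[of _ r] conjI allI)
    show "l - k = (\<Sum>p | r p \<noteq> 0. (- 1) ^ p * int (r p))"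
      unfolding a(3) x(3) **(3) by (rule add_diff_cancel_left')
  qed (fact r **(2))+
qed

lemma ec_pair_total:
  assumes A: "has_euler_characteristic (subtopology X S) k" and R: "ec_pair X S l"
  shows "has_euler_characteristic X (k + l)"
proof -
  obtain a :: "nat \<Rightarrow> nat" where a: "\<And>p. has_rank (homology_group (int p) (subtopology X S)) (a p)"
     "finite {p. a p \<noteq> 0}" "k = (\<Sum>p | a p \<noteq> 0. (- 1) ^ p * int (a p))"
    using A unfolding has_euler_characteristic_def by blast
  obtain r :: "nat \<Rightarrow> nat" where r: "\<And>p. has_rank (relative_homology_group (int p) X S) (r p)"
     "finite {p. r p \<noteq> 0}" "l = (\<Sum>p | r p \<noteq> 0. (- 1) ^ p * int (r p))"
    using R unfolding ec_pair_def by blast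
  have "\<exists>m. has_rank (homology_group (int p) X) m" for p
    by (rule exact_middle_rank[OF _ _ _ _ _ _ a(1) r(1), where f = "hom_induced (int p) (subtopology X S) {} X {} id" and g = "hom_induced (int p) X {} X S id"])
       (use homology_exactness_axiom_3[of "int p" X S] in \<open>auto simp: hom_induced_hom\<close>)
  then obtain x where x: "\<And>p. has_rank (homology_group (int p) X) (x p)" by metis
  obtain i g d where *: "\<And>p. x p = i p + g p" "\<And>p. r p = g p + d p"
    "\<And>p. a p = d (Suc p) + i p" "d 0 = 0"
    using long_exact_ranks[OF a(1) x r(1)] by auto
  note ** = alternating_sum_exact[of x i g r d a, OF *(1,2,3,4) a(2) disjI2[OF r(2)]]
  show ?thesis
    unfolding has_euler_characteristic_def
  proof (intro exI[of _ x] conjI allI)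
    show "k + l = (\<Sum>p | x p \<noteq> 0. (- 1) ^ p * int (x p))"
      unfolding a(3) r(3) **(3) ..
  qed (fact x **(1))+
qed

lemma ec_pair_iso:
  assumes "\<And>p. relative_homology_group p X S \<cong> relative_homology_group p Y T" "ec_pair X S k"
  shows "ec_pair Y T k"
proof -
  have "has_rank (relative_homology_group (int p) Y T) b"
    if "has_rank (relative_homology_group (int p) X S) b" for p b
    using has_rank_iso[OF _ _ assms(1) that] by simp
  moreover obtain b where "\<And>p. has_rank (relative_homology_group (int p) X S) (b p)"
      "finite {p. b p \<noteq> 0}" "k = (\<Sum>p | b p \<noteq> 0. (- 1) ^ p * int (b p))"
    using assms(2) unfolding ec_pair_def by blast
  ultimately show ?thesis
    unfolding ec_pair_def by (intro exI[of _ b]) simp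
qed

text \<open>Instead of a Mayer-Vietoris sequence, two sequences of pairs and excision are used: the
  pair of \<open>X\<close> and \<open>U\<close> has the homology of the pair of \<open>N\<close> and
  \<open>U \<inter> N\<close>, which contributes \<open>n - c\<close>.\<close>

lemma euler_characteristic_union:
  assumes U: "openin X U" and N: "openin X N" and UN: "U \<union> N = topspace X"
    and u: "has_euler_characteristic (subtopology X U) u"
    and n: "has_euler_characteristic (subtopology X N) n"
    and c: "has_euler_characteristic (subtopology X (U \<inter> N)) c"
  shows "has_euler_characteristic X (u + n - c)"
proof -
  have sub: "U \<subseteq> topspace X" "N \<subseteq> topspace X" using U N openin_subset by auto
  have "ec_pair (subtopology X N) (U \<inter> N) (n - c)"
    by (rule ec_pair_relative) (use n c in \<open>simp_all add: subtopology_subtopology Int_commute Int_left_commute\<close>)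
  moreover have "relative_homology_group p (subtopology X N) (U \<inter> N) \<cong> relative_homology_group p X U" for p
  proof -
    have cl: "closedin X (topspace X - N)" using N by blast
    \<comment> \<open>The set to be excised is the complement of \<open>N\<close>: it is closed, and
      it lies in the open set \<open>U\<close> because \<open>U\<close> and \<open>N\<close> cover
      the space.\<close>
    have "X closure_of (topspace X - N) \<subseteq> X interior_of U"
      using cl U UN by (auto simp: closure_of_closedin interior_of_openin)
    from homology_excision_axiom[OF this sub(1), of p]
    have "relative_homology_group p (subtopology X (topspace X - (topspace X - N))) (U - (topspace X - N)) \<cong>
          relative_homology_group p (subtopology X (topspace X)) U"
      unfolding is_iso_def by blast
    moreover have "topspace X - (topspace X - N) = N" "U - (topspace X - N) = U \<inter> N" using sub by auto
    ultimately show ?thesis by simp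
  qed
  ultimately have "ec_pair X U (n - c)"
    by (rule ec_pair_iso[rotated])
  from ec_pair_total[OF u this] show ?thesis by (simp add: algebra_simps)
qed

section \<open>Euler characteristics of elementary spaces and of retracts\<close>

lemma has_euler_characteristic_homotopy_equivalent:
  assumes "X homotopy_equivalent_space Y" "has_euler_characteristic X k"
  shows "has_euler_characteristic Y k"
  using assms homotopy_equivalent_space_imp_isomorphic_homology_groups
  unfolding ec_pair_empty[symmetric] by (metis ec_pair_iso)

lemma has_euler_characteristic_empty:
  assumes "topspace X = {}"
  shows "has_euler_characteristic X 0"
  unfolding has_euler_characteristic_def
  by (rule exI[of _ "\<lambda>_. 0"]) (simp add: has_rank_trivial[OF trivial_homology_group_empty[OF assms]])

lemma has_rank_integer_group: "has_rank integer_group 1"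
proof -
  interpret comm_group integer_group by (rule abelian_integer_group)
  have "int_independent integer_group {1}"
    unfolding int_independent_def
  proof (intro conjI allI impI)
    fix F and c :: "int \<Rightarrow> int"
    assume F: "finite F \<and> F \<subseteq> {1} \<and> finprod integer_group (\<lambda>s. s [^]\<^bsub>integer_group\<^esub> c s) F = \<one>\<^bsub>integer_group\<^esub>"
    then consider "F = {}" | "F = {1}" by blast
    then show "\<forall>s\<in>F. c s = 0" using F by cases simp_all
  qed simp
  moreover have "finite S \<and> card S \<le> 1" if S: "int_independent integer_group S" for S
  proof -
    have eq: "a = b" if ab: "a \<in> S" "b \<in> S" for a b
    proof (rule ccontr)
      assume "a \<noteq> b"
      \<comment> \<open>Any two integers are dependent, as b * a - a * b = 0.\<close>
      define c where "c = (\<lambda>s. if s = a then b else - a)"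
      have "finprod integer_group (\<lambda>s. s [^]\<^bsub>integer_group\<^esub> c s) {a, b} = \<one>\<^bsub>integer_group\<^esub>"
        using \<open>a \<noteq> b\<close> by (simp add: c_def)
      then have "\<forall>s\<in>{a, b}. c s = 0"
        using S ab unfolding int_independent_def
        by (metis empty_subsetI finite.emptyI finite_insert insert_subset)
      then show False using \<open>a \<noteq> b\<close> by (auto simp: c_def)
    qed
    show ?thesis
    proof (cases "S = {}")
      case False
      then obtain a where "S = {a}" using eq by blast
      then show ?thesis by simp
    qed simp
  qed
  ultimately show ?thesis
    unfolding has_rank_def by (intro conjI exI[of _ "{1}"]) auto
qed

lemma has_euler_characteristic_singleton:
  assumes "topspace X = {a}"
  shows "has_euler_characteristic X 1"
proof -
  have "path_connected_space X"
    by (rule contractible_imp_path_connected_space[OF contractible_space_subset_singleton]) (use assms in simp)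
  then have "homology_group 0 X \<cong> integer_group"
    by (rule isomorphic_integer_zeroth_homology_group) (use assms in simp)
  then have "integer_group \<cong> homology_group 0 X"
    by (rule group.iso_sym[rotated]) simp
  then have "has_rank (homology_group 0 X) 1"
    by (rule has_rank_iso[OF abelian_integer_group _ _ has_rank_integer_group, rotated]) simp
  then have "has_rank (homology_group (int p) X) (if p = 0 then 1 else 0)" for p
    using has_rank_trivial[OF homology_dimension_axiom[OF assms], of "int p"] by auto
  then show ?thesis
    unfolding has_euler_characteristic_def by (intro exI[of _ "\<lambda>p. if p = 0 then 1 else 0"]) simp
qed

text \<open>The homology of a retract embeds into that of the space, so its ranks are finite and
  almost all zero. This yields existence only, not the value.\<close>

lemma has_euler_characteristic_retract:
  assumes f: "continuous_map Y X f" and g: "continuous_map X Y g" and gf: "\<And>y. y \<in> topspace Y \<Longrightarrow> g (f y) = y"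
    and X: "has_euler_characteristic X k"
  obtains l where "has_euler_characteristic Y l"
proof -
  obtain x :: "nat \<Rightarrow> nat" where x: "\<And>p. has_rank (homology_group (int p) X) (x p)" "finite {p. x p \<noteq> 0}"
    using X unfolding has_euler_characteristic_def by blast
  have "section_map Y X f"
    unfolding section_map_def retraction_maps_def using f g gf by blast
  then have mon: "hom_induced p Y {} X {} f \<in> mon (homology_group p Y) (homology_group p X)" for p
    by (rule mon_hom_induced_section_map)
  have "\<exists>m\<le>x p. has_rank (homology_group (int p) Y) m" for p
  proof -
    let ?h = "hom_induced (int p) Y {} X {} f" and ?Y = "homology_group (int p) Y" and ?X = "homology_group (int p) X"
    have h: "?h \<in> hom ?Y ?X" "inj_on ?h (carrier ?Y)" using mon[of "int p"] by (simp_all add: mon_def)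
    have ker: "kernel ?Y ?X ?h \<subseteq> {\<one>\<^bsub>?Y\<^esub>}"
    proof
      fix y assume "y \<in> kernel ?Y ?X ?h"
      then have y: "y \<in> carrier ?Y" "?h y = \<one>\<^bsub>?X\<^esub>" by (auto simp: kernel_def)
      have "?h \<one>\<^bsub>?Y\<^esub> = \<one>\<^bsub>?X\<^esub>" by (rule hom_one[OF h(1)]) simp_all
      then have "y = \<one>\<^bsub>?Y\<^esub>"
        by (intro inj_onD[OF h(2)]) (use y in \<open>auto simp only: intro: monoid.one_closed group.is_monoid group_relative_homology_group\<close>)
      then show "y \<in> {\<one>\<^bsub>?Y\<^esub>}" by simp
    qed
    have "?h ` carrier ?Y \<subseteq> carrier ?X" using h(1) by (auto simp: hom_def)
    then obtain m where m: "m \<le> x p" "rank_on ?X (?h ` carrier ?Y) m"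
      using rank_on_subset x(1)[of p] unfolding has_rank_rank_on by metis
    have "has_rank ?Y (0 + m)"
      by (rule rank_nullity[OF _ _ h(1) rank_on_trivial[OF _ ker] m(2)]) simp_all
    then show ?thesis using m(1) by (intro exI[of _ m]) simp
  qed
  then obtain y where y: "\<And>p. y p \<le> x p" "\<And>p. has_rank (homology_group (int p) Y) (y p)"
    by metis
  have "x p \<noteq> 0" if "y p \<noteq> 0" for p using y(1)[of p] that by simp
  then have "finite {p. y p \<noteq> 0}"
    by (intro finite_subset[OF _ x(2)] Collect_mono) simp
  then have "has_euler_characteristic Y (\<Sum>p | y p \<noteq> 0. (- 1) ^ p * int (y p))"
    using y(2) unfolding has_euler_characteristic_def by (intro exI[of _ y]) simp
  then show ?thesis by (rule that)
qed

section \<open>Circle factors and divisors\<close>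

abbreviation set_ec :: "'a::topological_space set \<Rightarrow> int \<Rightarrow> bool" where
  "set_ec X k \<equiv> has_euler_characteristic (top_of_set X) k"

lemma set_ec_union:
  assumes "openin (top_of_set X) U" "openin (top_of_set X) N" "U \<union> N = X"
    and "set_ec U u" "set_ec N n" "set_ec (U \<inter> N) c"
  shows "set_ec X (u + n - c)"
proof -
  have *: "subtopology (top_of_set X) W = top_of_set W" if "W \<subseteq> X" for W
    using that by (simp add: subtopology_subtopology inf.absorb2)
  have "U \<subseteq> X" "N \<subseteq> X" "U \<inter> N \<subseteq> X" using assms(3) by auto
  note ** = this[THEN *]
  show ?thesis
    by (rule euler_characteristic_union[where U = U and N = N]) (simp_all only: ** assms topspace_euclidean_subtopology)
qed

lemma homotopy_equivalent_deformation:
  fixes A :: "'a::topological_space set" and B :: "'b::topological_space set"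
  assumes r: "continuous_on A r" "r \<in> A \<rightarrow> B" and s: "continuous_on B s" "s \<in> B \<rightarrow> A"
    and rs: "\<And>y. y \<in> B \<Longrightarrow> r (s y) = y"
    and h: "continuous_on ({0..1} \<times> A) h" "h \<in> {0..1::real} \<times> A \<rightarrow> A"
    and h0: "\<And>x. x \<in> A \<Longrightarrow> h (0, x) = s (r x)" and h1: "\<And>x. x \<in> A \<Longrightarrow> h (1, x) = x"
  shows "top_of_set A homotopy_equivalent_space top_of_set B"
  unfolding homotopy_equivalent_space_def
proof (intro exI conjI)
  show "continuous_map (top_of_set A) (top_of_set B) r" using r by simp
  show "continuous_map (top_of_set B) (top_of_set A) s" using s by simp
  show "homotopic_with (\<lambda>x. True) (top_of_set A) (top_of_set A) (s \<circ> r) id"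
    by (subst homotopic_with) (use h h0 h1 in \<open>auto intro!: exI[of _ h]\<close>)
  show "homotopic_with (\<lambda>x. True) (top_of_set B) (top_of_set B) (r \<circ> s) id"
    by (rule homotopic_with_equal) (use rs r s in \<open>auto intro!: continuous_on_compose2[OF r(1) s(1)] simp: o_def\<close>)
qed

lemma set_ec_deformation:
  fixes A :: "'a::topological_space set" and B :: "'b::topological_space set"
  assumes "continuous_on A r" "r \<in> A \<rightarrow> B" and "continuous_on B s" "s \<in> B \<rightarrow> A"
    and "\<And>y. y \<in> B \<Longrightarrow> r (s y) = y"
    and "continuous_on ({0..1} \<times> A) h" "h \<in> {0..1::real} \<times> A \<rightarrow> A"
    and "\<And>x. x \<in> A \<Longrightarrow> h (0, x) = s (r x)" and "\<And>x. x \<in> A \<Longrightarrow> h (1, x) = x"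
  shows "set_ec A k \<longleftrightarrow> set_ec B k"
  using has_euler_characteristic_homotopy_equivalent homotopy_equivalent_deformation[OF assms]
  by (metis homotopy_equivalent_space_sym)

lemma set_ec_homeomorphic:
  fixes A :: "'a::topological_space set" and B :: "'b::topological_space set"
  assumes "continuous_on A r" "r \<in> A \<rightarrow> B" and "continuous_on B s" "s \<in> B \<rightarrow> A"
    and "\<And>y. y \<in> B \<Longrightarrow> r (s y) = y" "\<And>x. x \<in> A \<Longrightarrow> s (r x) = x"
  shows "set_ec A k \<longleftrightarrow> set_ec B k"
  by (rule set_ec_deformation[of A r B s "\<lambda>p. snd p"])
     (use assms in \<open>auto intro!: continuous_intros\<close>)

lemma set_ec_star_times:
  fixes D :: "complex set" and F :: "'a::topological_space set"
  assumes star: "\<And>z t. z \<in> D \<Longrightarrow> 0 \<le> t \<Longrightarrow> t \<le> 1 \<Longrightarrow> c + of_real t * (z - c) \<in> D" and c: "c \<in> D"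
    and F: "set_ec F k"
  shows "set_ec (D \<times> F) k"
proof -
  have "set_ec (D \<times> F) k \<longleftrightarrow> set_ec F k"
  proof (rule set_ec_deformation)
    show "continuous_on ({0..1} \<times> D \<times> F) (\<lambda>p. (c + of_real (fst p) * (fst (snd p) - c), snd (snd p)))"
      by (intro continuous_intros)
  qed (use star c in \<open>auto intro!: continuous_intros\<close>)
  then show ?thesis using F by simp
qed

text \<open>C^* is covered by two slit planes, both star-shaped, that meet in two disjoint
  half-planes. The count is k + k - (k + k) = 0.\<close>

lemma set_ec_punctured_plane_times:
  fixes F :: "'a::topological_space set"
  assumes F: "set_ec F k"
  shows "set_ec ((- {0::complex}) \<times> F) 0"
proof -
  let ?X = "(- {0::complex}) \<times> F"
  have opn: "openin (top_of_set X) (O' \<times> F)" if "X = X' \<times> F" "O' \<subseteq> X'" "open O'" for X X' and O' :: "complex set"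
  proof -
    have "O' \<times> F = X \<inter> (O' \<times> UNIV)" using that by auto
    then show ?thesis using that by (simp add: openin_open_Int open_Times)
  qed
  let ?U = "(- (\<real>\<^sub>\<le>\<^sub>0 :: complex set)) \<times> F" and ?N = "(- (\<real>\<^sub>\<ge>\<^sub>0 :: complex set)) \<times> F"
  let ?P = "{z. Im z > 0} \<times> F" and ?Q = "{z. Im z < 0} \<times> F"
  have U: "set_ec ?U k"
  proof (rule set_ec_star_times[where c = 1])
    \<comment> \<open>The segment from 1 to \<open>z\<close> stays on the positive axis if
      \<open>z\<close> is real; otherwise it leaves the real axis for every positive
      \<open>t\<close>.\<close>
    show "1 + of_real t * (z - 1) \<in> - \<real>\<^sub>\<le>\<^sub>0" if "z \<in> - \<real>\<^sub>\<le>\<^sub>0" "0 \<le> t" "t \<le> 1" for z :: complex and t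
    proof (cases "Im z = 0")
      case True
      then have "Re z > 0" using that by (auto simp: complex_nonpos_Reals_iff)
      then have "1 + t * (Re z - 1) > 0"
      proof (cases "t = 0")
        case False
        then have "t * Re z > 0" using that \<open>Re z > 0\<close> by simp
        then show ?thesis using that by (simp add: algebra_simps)
      qed simp
      then show ?thesis by (auto simp: complex_nonpos_Reals_iff)
    next
      case False
      then show ?thesis using that by (cases "t = 0") (auto simp: complex_nonpos_Reals_iff)
    qed
  qed (use F in \<open>auto simp: complex_nonpos_Reals_iff\<close>)
  have N: "set_ec ?N k"
  proof (rule set_ec_star_times[where c = "- 1"])
    show "- 1 + of_real t * (z - (- 1)) \<in> - \<real>\<^sub>\<ge>\<^sub>0" if "z \<in> - \<real>\<^sub>\<ge>\<^sub>0" "0 \<le> t" "t \<le> 1" for z :: complex and t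
    proof (cases "Im z = 0")
      case True
      then have "Re z < 0" using that by (auto simp: complex_nonneg_Reals_iff)
      then have "- 1 + t * (Re z + 1) < 0"
      proof (cases "t = 0")
        case False
        then have "t * Re z < 0" using that \<open>Re z < 0\<close> by (simp add: mult_less_0_iff)
        then show ?thesis using that by (simp add: algebra_simps)
      qed simp
      then show ?thesis by (auto simp: complex_nonneg_Reals_iff)
    next
      case False
      then show ?thesis using that by (cases "t = 0") (auto simp: complex_nonneg_Reals_iff)
    qed
  qed (use F in \<open>auto simp: complex_nonneg_Reals_iff\<close>)
  have cone: "1 + t * (x - 1) > 0" if "x > 0" "0 \<le> t" "t \<le> 1" for x t :: real
  proof (cases "t = 0")
    case False
    then have "t * x > 0" using that by simp
    then show ?thesis using that by (simp add: algebra_simps)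
  qed simp
  have P: "set_ec ?P k"
  proof (rule set_ec_star_times[where c = \<i>])
    show "\<i> + of_real t * (z - \<i>) \<in> {z. 0 < Im z}" if "z \<in> {z. 0 < Im z}" "0 \<le> t" "t \<le> 1" for z t
      using cone[of "Im z" t] that by simp
  qed (use F in simp_all)
  have Q: "set_ec ?Q k"
  proof (rule set_ec_star_times[where c = "- \<i>"])
    show "- \<i> + of_real t * (z - (- \<i>)) \<in> {z. Im z < 0}" if "z \<in> {z. Im z < 0}" "0 \<le> t" "t \<le> 1" for z t
      using cone[of "- Im z" t] that by (simp add: algebra_simps)
  qed (use F in simp_all)
  have "set_ec (?P \<union> ?Q) (k + k - 0)"
  proof (rule set_ec_union)
    have e: "?P \<union> ?Q = {z. Im z \<noteq> 0} \<times> F" by auto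
    show "openin (top_of_set (?P \<union> ?Q)) ?P"
      by (rule opn[OF e]) (auto intro: open_halfspace_Im_gt)
    show "openin (top_of_set (?P \<union> ?Q)) ?Q"
      by (rule opn[OF e]) (auto intro: open_halfspace_Im_lt)
    have "?P \<inter> ?Q = {}" by auto
    then show "set_ec (?P \<inter> ?Q) 0" by (simp add: has_euler_characteristic_empty)
  qed (use P Q in auto)
  moreover have "?P \<union> ?Q = ?U \<inter> ?N"
    by (auto simp: complex_nonpos_Reals_iff complex_nonneg_Reals_iff)
  ultimately have I: "set_ec (?U \<inter> ?N) (k + k)" by simp
  have "set_ec ?X (k + k - (k + k))"
  proof (rule set_ec_union)
    show "openin (top_of_set ?X) ?U"
      by (rule opn[OF refl]) (auto simp: closed_nonpos_Reals_complex open_Compl)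
    show "openin (top_of_set ?X) ?N"
      by (rule opn[OF refl]) (auto simp: closed_nonneg_Reals_complex open_Compl)
    show "?U \<union> ?N = ?X"
      by (auto simp: complex_nonpos_Reals_iff complex_nonneg_Reals_iff complex_eq_iff)
  qed (use U N I in auto)
  then show ?thesis by simp
qed

text \<open>The equivariant map \<open>g\<close> to \<open>\<complex>\<^sup>*\<close> makes \<open>Y\<close> the product of \<open>\<complex>\<^sup>*\<close> and a fibre of \<open>g\<close>.\<close>

locale slice =
  fixes Y :: "'a::topological_space set" and g :: "'a \<Rightarrow> complex" and T :: "complex \<Rightarrow> 'a \<Rightarrow> 'a" and c :: complex
  assumes g: "continuous_on Y g" "\<And>z. z \<in> Y \<Longrightarrow> g z \<noteq> 0"
    and T: "continuous_on ((- {0::complex}) \<times> Y) (\<lambda>p. T (fst p) (snd p))" "\<And>t z. t \<noteq> 0 \<Longrightarrow> z \<in> Y \<Longrightarrow> T t z \<in> Y"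
    and T1: "\<And>z. z \<in> Y \<Longrightarrow> T 1 z = z"
    and TT: "\<And>s t z. s \<noteq> 0 \<Longrightarrow> t \<noteq> 0 \<Longrightarrow> z \<in> Y \<Longrightarrow> T s (T t z) = T (s * t) z"
    and gT: "\<And>t z. t \<noteq> 0 \<Longrightarrow> z \<in> Y \<Longrightarrow> g (T t z) = t * g z"
    and c: "c \<noteq> 0"
begin

lemma T_compose:
  assumes "continuous_on S f" "continuous_on S h" "\<And>x. x \<in> S \<Longrightarrow> f x \<noteq> 0" "\<And>x. x \<in> S \<Longrightarrow> h x \<in> Y"
  shows "continuous_on S (\<lambda>x. T (f x) (h x))"
proof -
  have "continuous_on S (\<lambda>x. (f x, h x))" using assms by (intro continuous_intros)
  from continuous_on_compose2[OF T(1) this] assms show ?thesis by auto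
qed

lemma set_ec_product: "set_ec Y k \<longleftrightarrow> set_ec ((- {0::complex}) \<times> {z \<in> Y. g z = c}) k"
\<comment> \<open>\<open>T (c / g z) z\<close> is the point at which the orbit of \<open>z\<close>
  meets the fibre over \<open>c\<close>, and \<open>g z / c\<close> is the parameter that leads back
  to \<open>z\<close>.\<close>
proof (rule set_ec_homeomorphic[where r = "\<lambda>z. (g z / c, T (c / g z) z)" and s = "\<lambda>p. T (fst p) (snd p)"])
  show "continuous_on Y (\<lambda>z. (g z / c, T (c / g z) z))"
    using g c by (intro continuous_intros T_compose) auto
  show "continuous_on ((- {0::complex}) \<times> {z \<in> Y. g z = c}) (\<lambda>p. T (fst p) (snd p))"
    by (rule continuous_on_subset[OF T(1)]) auto
  show "(\<lambda>z. (g z / c, T (c / g z) z)) \<in> Y \<rightarrow> (- {0::complex}) \<times> {z \<in> Y. g z = c}"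
    using g c T(2) gT by auto
  show "(\<lambda>p. T (fst p) (snd p)) \<in> (- {0::complex}) \<times> {z \<in> Y. g z = c} \<rightarrow> Y"
    by (auto intro: T(2))
  show "(g (T (fst y) (snd y)) / c, T (c / g (T (fst y) (snd y))) (T (fst y) (snd y))) = y"
    if "y \<in> (- {0::complex}) \<times> {z \<in> Y. g z = c}" for y
    using that c gT TT T1 by (cases y) auto
  show "T (fst (g x / c, T (c / g x) x)) (snd (g x / c, T (c / g x) x)) = x" if "x \<in> Y" for x
    using that g(2)[OF that] c TT[of "g x / c" "c / g x" x] T1 by simp
qed

lemma set_ec_zero: "set_ec {z \<in> Y. g z = c} k \<Longrightarrow> set_ec Y 0"
  using set_ec_product set_ec_punctured_plane_times by blast

text \<open>The same projection along orbits retracts the total space to the fibre. This supplies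
  the hypothesis of \<open>set_ec_zero\<close>.\<close>

lemma set_ec_slice_exists:
  assumes "set_ec Y k"
  obtains l where "set_ec {z \<in> Y. g z = c} l"
proof (rule has_euler_characteristic_retract)
  show "continuous_map (top_of_set {z \<in> Y. g z = c}) (top_of_set Y) id" by auto
  show "continuous_map (top_of_set Y) (top_of_set {z \<in> Y. g z = c}) (\<lambda>z. T (c / g z) z)"
    using g c gT T(2) by (auto intro!: continuous_intros T_compose)
  show "T (c / g (id y)) (id y) = y" if "y \<in> topspace (top_of_set {z \<in> Y. g z = c})" for y
    using that c T1 by auto
qed (use assms that in auto)

end

text \<open>
  \<open>D u v\<close> moves a point of the neighbourhood \<open>N\<close> of the divisor \<open>p = 0\<close> to the point with
  \<open>p = u\<close> and \<open>q = v\<close> in the same fibre of a trivialization of \<open>N\<close> over \<open>\<bar>u v\<bar> < 1\<close>.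
\<close>

lemma set_ec_divisor:
  fixes Y :: "'a::topological_space set" and p q :: "'a \<Rightarrow> complex" and D :: "complex \<Rightarrow> complex \<Rightarrow> 'a \<Rightarrow> 'a"
  defines "N \<equiv> {z \<in> Y. norm (p z * q z) < 1}"
  assumes p: "continuous_on Y p" and q: "continuous_on Y q"
    and D: "continuous_on ({(u, v). norm (u * v) < 1} \<times> N) (\<lambda>w. D (fst (fst w)) (snd (fst w)) (snd w))"
    and DY: "\<And>u v z. norm (u * v) < 1 \<Longrightarrow> z \<in> N \<Longrightarrow> D u v z \<in> Y"
    and pD: "\<And>u v z. norm (u * v) < 1 \<Longrightarrow> z \<in> N \<Longrightarrow> p (D u v z) = u"
    and qD: "\<And>u v z. norm (u * v) < 1 \<Longrightarrow> z \<in> N \<Longrightarrow> q (D u v z) = v"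
    and D_id: "\<And>z. z \<in> N \<Longrightarrow> D (p z) (q z) z = z"
    and D_D: "\<And>u v u' v' z. norm (u * v) < 1 \<Longrightarrow> norm (u' * v') < 1 \<Longrightarrow> z \<in> N \<Longrightarrow> D u v (D u' v' z) = D u v z"
    and a: "set_ec {z \<in> Y. p z \<noteq> 0} a" and b: "set_ec {z \<in> Y. p z = 0} b"
  shows "set_ec Y (a + b)"
proof -
  \<comment> \<open>The central fibre of the trivialization. The divisor, its neighbourhood and the
    punctured neighbourhood are all compared with \<open>F\<close>.\<close>
  define F where "F = {z \<in> N. p z = 0 \<and> q z = 0}"
  have DN: "D u v z \<in> N" if "norm (u * v) < 1" "z \<in> N" for u v z
    using DY[OF that] pD[OF that] qD[OF that] that by (simp add: N_def)
  have pN: "continuous_on N p" and qN: "continuous_on N q"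
    using p q by (auto simp: N_def intro: continuous_on_subset)
  have Dc: "continuous_on S (\<lambda>x. D (f x) (g x) (k x))"
    if "continuous_on S f" "continuous_on S g" "continuous_on S k" "\<And>x. x \<in> S \<Longrightarrow> norm (f x * g x) < 1"
      "\<And>x. x \<in> S \<Longrightarrow> k x \<in> N" for S :: "'c::topological_space set" and f g k
  proof -
    have "continuous_on S (\<lambda>x. ((f x, g x), k x))" using that by (intro continuous_intros)
    moreover have "(\<lambda>x. ((f x, g x), k x)) ` S \<subseteq> {(u, v). norm (u * v) < 1} \<times> N" using that(4,5) by auto
    ultimately show ?thesis using continuous_on_compose2[OF D] by fastforce
  qed
  \<comment> \<open>The region |u v| < 1 is stable under shrinking either coordinate, so the
    homotopies below may simply scale \<open>p\<close> and \<open>q\<close> towards 0.\<close>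
  have small: "norm (of_real t * x * y) < 1" "norm (x * (of_real t * y)) < 1"
     "norm (of_real t * x * (of_real t * y)) < 1"
    if "norm (x * y) < 1" "0 \<le> t" "t \<le> 1" for t and x y :: complex
  proof -
    have *: "r * norm (x * y) < 1" if "0 \<le> r" "r \<le> 1" for r
      using \<open>norm (x * y) < 1\<close> mult_left_le_one_le[of "norm (x * y)" r] that by (simp add: mult.commute)
    show "norm (of_real t * x * y) < 1" "norm (x * (of_real t * y)) < 1"
      using *[of t] that by (simp_all add: norm_mult mult_ac)
    show "norm (of_real t * x * (of_real t * y)) < 1"
      using *[of "t * t"] that by (simp add: norm_mult mult_ac mult_le_one)
  qed
  have Nn: "norm (p z * q z) < 1" if "z \<in> N" for z using that by (simp add: N_def)
  have "set_ec {z \<in> Y. p z = 0} b \<longleftrightarrow> set_ec F b"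
  proof (rule set_ec_deformation[where r = "\<lambda>z. D 0 0 z" and s = "\<lambda>z. z" and
        h = "\<lambda>w. D 0 (of_real (fst w) * q (snd w)) (snd w)"])
    have Z: "{z \<in> Y. p z = 0} \<subseteq> N" by (auto simp: N_def)
    have qZ: "continuous_on {z \<in> Y. p z = 0} q" using q by (rule continuous_on_subset) auto
    show "continuous_on {z \<in> Y. p z = 0} (\<lambda>z. D 0 0 z)"
      using Z by (intro Dc continuous_intros) auto
    show "(\<lambda>z. D 0 0 z) \<in> {z \<in> Y. p z = 0} \<rightarrow> F"
      using Z DN pD qD by (auto simp: F_def)
    show "(\<lambda>z. z) \<in> F \<rightarrow> {z \<in> Y. p z = 0}" by (auto simp: F_def N_def)
    show "D 0 0 y = y" if "y \<in> F" for y using D_id[of y] that by (auto simp: F_def)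
    show "continuous_on ({0..1} \<times> {z \<in> Y. p z = 0}) (\<lambda>w. D 0 (of_real (fst w) * q (snd w)) (snd w))"
      using Z by (intro Dc continuous_intros continuous_on_compose2[OF qZ]) auto
    show "(\<lambda>w. D 0 (of_real (fst w) * q (snd w)) (snd w)) \<in> {0..1} \<times> {z \<in> Y. p z = 0} \<rightarrow> {z \<in> Y. p z = 0}"
      using Z DY pD by auto
    show "D 0 (of_real (fst (0, x)) * q (snd (0, x))) (snd (0, x)) = D 0 0 x" for x by simp
    show "D 0 (of_real (fst (1, x)) * q (snd (1, x))) (snd (1, x)) = x" if "x \<in> {z \<in> Y. p z = 0}" for x
      using D_id[of x] Z that by auto
  qed (auto intro: continuous_intros)
  then have F: "set_ec F b" using b by simp
  have "set_ec N b \<longleftrightarrow> set_ec F b"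
  proof (rule set_ec_deformation[where r = "\<lambda>z. D 0 0 z" and s = "\<lambda>z. z" and
        h = "\<lambda>w. D (of_real (fst w) * p (snd w)) (of_real (fst w) * q (snd w)) (snd w)"])
    show "continuous_on N (\<lambda>z. D 0 0 z)"
      by (intro Dc continuous_intros) auto
    show "(\<lambda>z. D 0 0 z) \<in> N \<rightarrow> F"
      using DN pD qD by (auto simp: F_def)
    show "(\<lambda>z. z) \<in> F \<rightarrow> N" by (auto simp: F_def)
    show "D 0 0 y = y" if "y \<in> F" for y using D_id[of y] that by (auto simp: F_def)
    show "continuous_on ({0..1} \<times> N) (\<lambda>w. D (of_real (fst w) * p (snd w)) (of_real (fst w) * q (snd w)) (snd w))"
      using small Nn by (intro Dc continuous_intros continuous_on_compose2[OF qN] continuous_on_compose2[OF pN]) auto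
    show "(\<lambda>w. D (of_real (fst w) * p (snd w)) (of_real (fst w) * q (snd w)) (snd w)) \<in> {0..1} \<times> N \<rightarrow> N"
      using small Nn DN by auto
    show "D (of_real (fst (1, x)) * p (snd (1, x))) (of_real (fst (1, x)) * q (snd (1, x))) (snd (1, x)) = x" if "x \<in> N" for x
      using D_id[of x] that by auto
  qed (auto intro: continuous_intros)
  then have N: "set_ec N b" using F by simp
  let ?U = "{z \<in> Y. p z \<noteq> 0}"
  \<comment> \<open>Here only \<open>q\<close> is shrunk; \<open>p\<close> must stay nonzero and
    becomes the coordinate on C^*.\<close>
  have "set_ec (?U \<inter> N) 0 \<longleftrightarrow> set_ec ((- {0::complex}) \<times> F) 0"
  proof (rule set_ec_deformation[where r = "\<lambda>z. (p z, D 0 0 z)" and s = "\<lambda>w. D (fst w) 0 (snd w)" and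
        h = "\<lambda>w. D (p (snd w)) (of_real (fst w) * q (snd w)) (snd w)"])
    have UN: "continuous_on (?U \<inter> N) p" "continuous_on (?U \<inter> N) q"
      using pN qN by (auto intro: continuous_on_subset)
    show "continuous_on (?U \<inter> N) (\<lambda>z. (p z, D 0 0 z))"
      using UN by (intro Dc continuous_intros) auto
    show "(\<lambda>z. (p z, D 0 0 z)) \<in> ?U \<inter> N \<rightarrow> (- {0::complex}) \<times> F"
      using DN pD qD by (auto simp: F_def)
    show "continuous_on ((- {0::complex}) \<times> F) (\<lambda>w. D (fst w) 0 (snd w))"
      by (intro Dc continuous_intros) (auto simp: F_def)
    show "(\<lambda>w. D (fst w) 0 (snd w)) \<in> (- {0::complex}) \<times> F \<rightarrow> ?U \<inter> N"
      using DN DY pD by (auto simp: F_def)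
    show "(p (D (fst y) 0 (snd y)), D 0 0 (D (fst y) 0 (snd y))) = y" if "y \<in> (- {0::complex}) \<times> F" for y
      using that pD D_D D_id[of "snd y"] by (cases y) (auto simp: F_def)
    show "continuous_on ({0..1} \<times> (?U \<inter> N)) (\<lambda>w. D (p (snd w)) (of_real (fst w) * q (snd w)) (snd w))"
      using small Nn by (intro Dc continuous_intros continuous_on_compose2[OF UN(1)] continuous_on_compose2[OF UN(2)]) auto
    show "(\<lambda>w. D (p (snd w)) (of_real (fst w) * q (snd w)) (snd w)) \<in> {0..1} \<times> (?U \<inter> N) \<rightarrow> ?U \<inter> N"
      using small Nn DN DY pD by auto
    show "D (p (snd (0, x))) (of_real (fst (0, x)) * q (snd (0, x))) (snd (0, x)) = D (fst (p x, D 0 0 x)) 0 (snd (p x, D 0 0 x))"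
      if "x \<in> ?U \<inter> N" for x
      using D_D[of "p x" 0 0 0 x] that by simp
    show "D (p (snd (1, x))) (of_real (fst (1, x)) * q (snd (1, x))) (snd (1, x)) = x" if "x \<in> ?U \<inter> N" for x
      using D_id[of x] that by auto
  qed
  then have UN: "set_ec (?U \<inter> N) 0" using set_ec_punctured_plane_times[OF F] by simp
  have "set_ec Y (a + b - 0)"
  proof (rule set_ec_union)
    have "?U = Y \<inter> p -` (- {0})" by auto
    then show "openin (top_of_set Y) ?U"
      using continuous_openin_preimage_gen[OF p, of "- {0}"] by (simp add: open_Compl)
    have "N = Y \<inter> (\<lambda>z. p z * q z) -` ball 0 1" by (auto simp: N_def)
    then show "openin (top_of_set Y) N"
      using continuous_openin_preimage_gen[OF continuous_on_mult[OF p q], of "ball 0 1"] by simp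
    show "?U \<union> N = Y" by (auto simp: N_def)
  qed (use a N UN in auto)
  then show ?thesis by simp
qed

section \<open>Matchings in forests\<close>

lemma adjacent_commute: "adjacent E u v \<longleftrightarrow> adjacent E v u"
  by (simp add: adjacent_def insert_commute)

locale acyclic_graph =
  fixes V :: "'v set" and E :: "'v set set"
  assumes graph: "finite_graph V E" and acyclic: "\<nexists>vs. graph_cycle E vs"
begin

lemma finite_vertices: "finite V"
  using graph by (simp add: finite_graph_def)

lemma adjacent_vertices: "adjacent E u v \<Longrightarrow> u \<in> V \<and> v \<in> V"
  using graph by (auto simp: finite_graph_def adjacent_def)

lemma not_adjacent_self: "\<not> adjacent E u u"
  using graph by (auto simp: finite_graph_def adjacent_def)

text \<open>Take the first vertex of a longest path inside \<open>W\<close>. By maximality all its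
  neighbours in \<open>W\<close> lie on the path, and a neighbour other than the second vertex would
  close a cycle.\<close>

lemma exists_leaf:
  assumes W: "W \<subseteq> V" "W \<noteq> {}"
  obtains v where "v \<in> W" "\<And>a b. a \<in> W \<Longrightarrow> b \<in> W \<Longrightarrow> adjacent E v a \<Longrightarrow> adjacent E v b \<Longrightarrow> a = b"
proof -
  define P where "P vs \<longleftrightarrow> vs \<noteq> [] \<and> distinct vs \<and> successively (adjacent E) vs \<and> set vs \<subseteq> W" for vs
  have finW: "finite W" using W finite_vertices finite_subset by blast
  obtain w where "w \<in> W" using W by blast
  then have "P [w]" by (simp add: P_def)
  moreover have "length vs < Suc (card W)" if "P vs" for vs
    using that card_mono[OF finW, of "set vs"] distinct_card[of vs] by (simp add: P_def)
  ultimately obtain vs where vs: "P vs" "\<And>us. P us \<Longrightarrow> length us \<le> length vs"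
    using ex_has_greatest_nat[of P "[w]" length "Suc (card W)"] by metis
  obtain v us where v: "vs = v # us" using vs(1) by (cases vs) (auto simp: P_def)
  have in_path: "a \<in> set us" if a: "a \<in> W" "adjacent E v a" for a
  proof (rule ccontr)
    assume "a \<notin> set us"
    then have "P (a # vs)"
      using vs(1) a not_adjacent_self adjacent_commute[of E] by (auto simp: P_def v)
    then show False using vs(2) by fastforce
  qed
  have second: "a = hd us" if a: "a \<in> W" "adjacent E v a" for a
  proof (rule ccontr)
    assume ne: "a \<noteq> hd us"
    obtain k where k: "k < length us" "us ! k = a" using in_path[OF a] by (auto simp: in_set_conv_nth)
    then have "k \<noteq> 0" using ne by (metis hd_conv_nth length_0_conv not_less0)
    \<comment> \<open>The entry \<open>us ! k\<close> is \<open>vs ! (k + 1)\<close>, so this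
      initial segment ends in \<open>a\<close>. Its length is at least 3 because \<open>k\<close> is
      not 0.\<close>
    let ?c = "take (k + 2) vs"
    have len: "length ?c = k + 2" using k by (simp add: v)
    have "successively (adjacent E) ?c"
      using vs(1) append_take_drop_id[of "k + 2" vs] unfolding P_def by (metis successively_append_iff)
    moreover have "distinct ?c" using vs(1) by (simp add: P_def)
    moreover have "last ?c = a" using len k by (subst last_conv_nth) (auto simp: v)
    moreover have "hd ?c = v" by (simp add: v)
    ultimately have "graph_cycle E ?c"
      using len \<open>k \<noteq> 0\<close> a by (simp add: graph_cycle_def adjacent_commute[of E])
    then show False using acyclic by blast
  qed
  show ?thesis
  proof (rule that)
    show "v \<in> W" using vs(1) by (simp add: P_def v)
  qed (use second in metis)
qed

text \<open>A leaf is added last and takes the colour opposite to that of its only neighbour. The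
  colouring will control the support of the weights below.\<close>

lemma two_coloring: obtains c :: "'v \<Rightarrow> bool" where "\<And>u v. adjacent E u v \<Longrightarrow> c u \<noteq> c v"
proof -
  have "\<exists>c :: 'v \<Rightarrow> bool. \<forall>u\<in>W. \<forall>v\<in>W. adjacent E u v \<longrightarrow> c u \<noteq> c v" if "W \<subseteq> V" for W
    using that
  proof (induction "card W" arbitrary: W)
    case 0
    then have "W = {}" using finite_vertices finite_subset by fastforce
    then show ?case by simp
  next
    case (Suc n)
    then have fin: "finite W" and "W \<noteq> {}" by (auto intro: card_ge_0_finite)
    then obtain l where l: "l \<in> W" "\<And>a b. a \<in> W \<Longrightarrow> b \<in> W \<Longrightarrow> adjacent E l a \<Longrightarrow> adjacent E l b \<Longrightarrow> a = b"
      using exists_leaf[OF Suc.prems] by metis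
    have "n = card (W - {l})" using Suc l fin by simp
    then obtain c :: "'v \<Rightarrow> bool" where c: "\<And>u v. u \<in> W - {l} \<Longrightarrow> v \<in> W - {l} \<Longrightarrow> adjacent E u v \<Longrightarrow> c u \<noteq> c v"
      using Suc.hyps(1)[of "W - {l}"] Suc.prems by blast
    define c' where "c' = c (l := \<not> (\<exists>p\<in>W. adjacent E l p \<and> c p))"
    have c'l: "c' l \<noteq> c' p" if "p \<in> W" "adjacent E l p" for p
      using l that not_adjacent_self by (auto simp: c'_def)
    have "c' u \<noteq> c' v" if "u \<in> W" "v \<in> W" "adjacent E u v" for u v
    proof (cases "u = l \<or> v = l")
      case True
      then show ?thesis using that c'l adjacent_commute[of E] by metis
    next
      case False
      then show ?thesis using that c[of u v] by (simp add: c'_def)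
    qed
    then show ?case by blast
  qed
  then obtain c :: "'v \<Rightarrow> bool" where "\<forall>u\<in>V. \<forall>v\<in>V. adjacent E u v \<longrightarrow> c u \<noteq> c v" by blast
  then show ?thesis using that adjacent_vertices by metis
qed

text \<open>A certificate for Koenig's theorem on the subgraph induced by \<open>W\<close>: a
  matching and a cover of equal size.\<close>

definition matching_with_cover :: "'v set \<Rightarrow> 'v set set \<Rightarrow> 'v set \<Rightarrow> bool" where
  "matching_with_cover W N C \<longleftrightarrow>
    N \<subseteq> {e \<in> E. e \<subseteq> W} \<and> (\<forall>v. \<forall>e\<in>N. \<forall>f\<in>N. v \<in> e \<and> v \<in> f \<longrightarrow> e = f) \<and>
    C \<subseteq> W \<and> (\<forall>u\<in>W. \<forall>v\<in>W. adjacent E u v \<longrightarrow> u \<in> C \<or> v \<in> C) \<and> card C = card N"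

lemma matching_with_coverD:
  assumes "matching_with_cover W N C"
  shows "N \<subseteq> {e \<in> E. e \<subseteq> W}" "\<forall>v. \<forall>e\<in>N. \<forall>f\<in>N. v \<in> e \<and> v \<in> f \<longrightarrow> e = f"
    "C \<subseteq> W" "\<forall>u\<in>W. \<forall>v\<in>W. adjacent E u v \<longrightarrow> u \<in> C \<or> v \<in> C" "card C = card N"
  using assms unfolding matching_with_cover_def by - (elim conjE, assumption)+

text \<open>Remove a leaf \<open>l\<close>. If it has a neighbour \<open>p\<close> in
  \<open>W\<close>, remove \<open>p\<close> as well, put the edge between them into the matching and
  \<open>p\<close> into the cover: \<open>p\<close> meets every edge that was lost.\<close>

lemma exists_matching_with_cover:
  assumes "W \<subseteq> V"
  shows "\<exists>N C. matching_with_cover W N C"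
  using assms
proof (induction "card W" arbitrary: W rule: less_induct)
  case less
  have finW: "finite W" using less.prems finite_vertices finite_subset by blast
  show ?case
  proof (cases "W = {}")
    case True
    then show ?thesis by (intro exI[of _ "{}"]) (simp add: matching_with_cover_def)
  next
    case False
    then obtain l where l: "l \<in> W" "\<And>a b. a \<in> W \<Longrightarrow> b \<in> W \<Longrightarrow> adjacent E l a \<Longrightarrow> adjacent E l b \<Longrightarrow> a = b"
      using exists_leaf[OF less.prems] by metis
    show ?thesis
    proof (cases "\<exists>p\<in>W. adjacent E l p")
      case False
      have "card (W - {l}) < card W" using finW l by (intro psubset_card_mono) auto
      moreover have "W - {l} \<subseteq> V" using less.prems by blast
      ultimately obtain N C where "matching_with_cover (W - {l}) N C"
        using less.hyps by blast
      note NC = matching_with_coverD[OF this]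
      have "u \<in> C \<or> v \<in> C" if "u \<in> W" "v \<in> W" "adjacent E u v" for u v
        using False NC(4) that adjacent_commute[of E] by blast
      moreover have "N \<subseteq> {e \<in> E. e \<subseteq> W}" "C \<subseteq> W" using NC(1,3) by blast+
      ultimately have "matching_with_cover W N C"
        unfolding matching_with_cover_def using NC(2,5) by simp
      then show ?thesis by blast
    next
      case True
      then obtain p where p: "p \<in> W" "adjacent E l p" by blast
      have lp: "l \<noteq> p" using p not_adjacent_self by auto
      have "card (W - {l, p}) < card W" using finW l by (intro psubset_card_mono) auto
      moreover have "W - {l, p} \<subseteq> V" using less.prems by blast
      ultimately obtain N C where "matching_with_cover (W - {l, p}) N C"
        using less.hyps by blast
      note NC = matching_with_coverD[OF this]
      have cov: "u \<in> insert p C \<or> v \<in> insert p C" if "u \<in> W" "v \<in> W" "adjacent E u v" for u v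
        using NC(4) that adjacent_commute[of E] l(2) p by blast
      have "finite C" using NC(3) finW finite_subset by blast
      moreover have "finite N" using NC(1) finW by (intro finite_subset[of N "Pow W"]) auto
      moreover have "p \<notin> C" "{l, p} \<notin> N" using NC by auto
      ultimately have cc: "card (insert p C) = card (insert {l, p} N)" using NC(5) by simp
      have "matching_with_cover W (insert {l, p} N) (insert p C)"
        unfolding matching_with_cover_def
      proof (intro conjI)
        show "insert {l, p} N \<subseteq> {e \<in> E. e \<subseteq> W}" using NC(1) l p by (auto simp: adjacent_def)
        show "\<forall>v. \<forall>e\<in>insert {l, p} N. \<forall>f\<in>insert {l, p} N. v \<in> e \<and> v \<in> f \<longrightarrow> e = f"
          using NC(1,2) by fast
        show "insert p C \<subseteq> W" using NC(3) p by auto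
        show "\<forall>u\<in>W. \<forall>v\<in>W. adjacent E u v \<longrightarrow> u \<in> insert p C \<or> v \<in> insert p C" using cov by blast
      qed (fact cc)
      then show ?thesis by blast
    qed
  qed
qed

end

section \<open>Perfectly matched subgraphs and the inverse of their adjacency matrix\<close>

locale matched_graph = acyclic_graph V E for V :: "'v set" and E :: "'v set set" +
  fixes M :: "'v set set"
  assumes maximum: "maximum_matching V E M"
begin

abbreviation nbs :: "'v \<Rightarrow> 'v set" where "nbs i \<equiv> {j \<in> V. adjacent E i j}"

definition partner :: "'v \<Rightarrow> 'v" where "partner v = (THE u. {v, u} \<in> M)"

lemma matching: "M \<subseteq> E" "\<And>v e f. v \<in> V \<Longrightarrow> e \<in> M \<Longrightarrow> f \<in> M \<Longrightarrow> v \<in> e \<Longrightarrow> v \<in> f \<Longrightarrow> e = f"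
  using maximum unfolding maximum_matching_def matching_def by blast+

lemma matched_vertices: "\<Union> M \<subseteq> V"
  using matching(1) graph by (auto simp: finite_graph_def)

lemma partner_unique: "{v, u} \<in> M \<Longrightarrow> partner v = u"
  unfolding partner_def
proof (rule the_equality)
  fix u' assume "{v, u} \<in> M" "{v, u'} \<in> M"
  then have "{v, u} = {v, u'}" using matching(2)[of v "{v, u}" "{v, u'}"] matched_vertices by auto
  then show "u' = u" by (auto simp: doubleton_eq_iff)
qed

lemma partner_edge:
  assumes "v \<in> \<Union> M"
  shows "{v, partner v} \<in> M"
proof -
  obtain e where e: "e \<in> M" "v \<in> e" using assms by blast
  then have "card e = 2" using matching(1) graph by (auto simp: finite_graph_def)
  then obtain u where "e = {v, u}" using e by (auto simp: card_2_iff)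
  then show ?thesis using e partner_unique by metis
qed

lemma partner:
  assumes "v \<in> \<Union> M"
  shows "partner v \<in> \<Union> M" "partner (partner v) = v" "adjacent E v (partner v)" "partner v \<noteq> v"
proof -
  note e = partner_edge[OF assms]
  show "partner v \<in> \<Union> M" using e by blast
  show "partner (partner v) = v" by (rule partner_unique) (use e in \<open>simp add: insert_commute\<close>)
  show a: "adjacent E v (partner v)" using e matching(1) by (auto simp: adjacent_def)
  show "partner v \<noteq> v" using a not_adjacent_self by metis
qed

text \<open>As \<open>W\<close> is closed under \<open>partner\<close>, a leaf of the induced
  subgraph has its partner as its only neighbour. Removing both keeps \<open>W\<close>
  closed.\<close>

lemma matched_leaf_induct [consumes 2, case_names empty leaf]:
  assumes "W \<subseteq> \<Union> M" "partner ` W \<subseteq> W"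
    and empty: "P {}"
    and leaf: "\<And>W l. W \<subseteq> \<Union> M \<Longrightarrow> partner ` W \<subseteq> W \<Longrightarrow> l \<in> W \<Longrightarrow> P (W - {l, partner l}) \<Longrightarrow>
      {k \<in> W. adjacent E l k} = {partner l} \<Longrightarrow> P W"
  shows "P W"
  using assms(1,2)
proof (induction "card W" arbitrary: W rule: less_induct)
  case less
  have WV: "W \<subseteq> V" using less.prems matched_vertices by blast
  then have finW: "finite W" using finite_vertices finite_subset by blast
  show ?case
  proof (cases "W = {}")
    case False
    then obtain l where l: "l \<in> W" "\<And>a b. a \<in> W \<Longrightarrow> b \<in> W \<Longrightarrow> adjacent E l a \<Longrightarrow> adjacent E l b \<Longrightarrow> a = b"
      using exists_leaf[OF WV] by metis
    have pl: "partner l \<in> W" "adjacent E l (partner l)"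
      using l(1) less.prems partner(3)[of l] by blast+
    show ?thesis
    proof (rule leaf[OF less.prems l(1)])
      show "{k \<in> W. adjacent E l k} = {partner l}" using l pl by blast
      show "P (W - {l, partner l})"
      proof (rule less.hyps)
        show "card (W - {l, partner l}) < card W" using finW l by (intro psubset_card_mono) auto
        show "W - {l, partner l} \<subseteq> \<Union> M" using less.prems by blast
        show "partner ` (W - {l, partner l}) \<subseteq> W - {l, partner l}"
        proof
          fix k assume "k \<in> partner ` (W - {l, partner l})"
          then obtain j where j: "j \<in> W" "j \<noteq> l" "j \<noteq> partner l" "k = partner j" by blast
          then have "k \<in> W" "partner k = j" using less.prems partner(2)[of j] by auto
          moreover have "partner (partner l) = l" using less.prems l partner(2)[of l] by blast
          ultimately show "k \<in> W - {l, partner l}" using j by auto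
        qed
      qed
    qed
  qed (simp add: empty)
qed

text \<open>The last condition makes \<open>w\<close> the column of index \<open>i\<close> of the
  inverse adjacency matrix of the subgraph on \<open>W\<close>; that \<open>w\<close> is integral
  expresses unimodularity. The condition on colours is carried along because it gives
  \<open>w i = 0\<close> and is used in the induction itself.\<close>

definition weights_on :: "('v \<Rightarrow> bool) \<Rightarrow> 'v set \<Rightarrow> 'v \<Rightarrow> ('v \<Rightarrow> int) \<Rightarrow> bool" where
  "weights_on c W i w \<longleftrightarrow> (\<forall>k. w k \<noteq> 0 \<longrightarrow> k \<in> W \<and> c k \<noteq> c i) \<and> w (partner i) = 1 \<and>
    (\<forall>k\<in>W. (\<Sum>l | l \<in> W \<and> adjacent E k l. w l) = (if k = i then 1 else 0))"

lemma weights_onD: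
  assumes "weights_on c W i w"
  shows "w k \<noteq> 0 \<Longrightarrow> k \<in> W" "w k \<noteq> 0 \<Longrightarrow> c k \<noteq> c i" "w (partner i) = 1"
    "k \<in> W \<Longrightarrow> (\<Sum>l | l \<in> W \<and> adjacent E k l. w l) = (if k = i then 1 else 0)"
  using assms unfolding weights_on_def by blast+

lemma weights_onI:
  fixes w :: "'v \<Rightarrow> int"
  assumes "\<And>k. w k \<noteq> 0 \<Longrightarrow> k \<in> W" "\<And>k. w k \<noteq> 0 \<Longrightarrow> c k \<noteq> c i" "w (partner i) = 1"
    "\<And>k. k \<in> W \<Longrightarrow> (\<Sum>l | l \<in> W \<and> adjacent E k l. w l) = (if k = i then 1 else 0)"
  shows "\<exists>w. weights_on c W i w"
  by (rule exI[of _ w]) (simp add: weights_on_def assms)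

text \<open>For a leaf \<open>l\<close> with partner \<open>p\<close>, the row of \<open>l\<close>
  prescribes \<open>w p\<close>, and the row of \<open>p\<close> then determines \<open>w l\<close>.
  On the remaining vertices one solves the smaller system, corrected for the value of
  \<open>w p\<close>.\<close>

lemma matched_weights:
  assumes W: "W \<subseteq> \<Union> M" "partner ` W \<subseteq> W" and c: "\<And>u v. adjacent E u v \<Longrightarrow> c u \<noteq> (c v :: bool)"
  shows "\<forall>i\<in>W. \<exists>w. weights_on c W i w"
  using W
proof (induction W rule: matched_leaf_induct)
  case (leaf W l)
  define p where "p = partner l"
  define W' where "W' = W - {l, p}"
  have finW: "finite W"
    by (rule finite_subset[OF subset_trans[OF leaf(1) matched_vertices] finite_vertices])
  then have finW': "finite W'" by (simp add: W'_def)
  have lM: "l \<in> \<Union> M" using leaf(1,3) by blast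
  have "p \<in> W" using leaf(2,3) by (auto simp: p_def)
  moreover have "adjacent E p l" using partner(3)[OF lM] by (simp add: p_def adjacent_commute[of E "partner l"])
  ultimately have p: "p \<in> W" "adjacent E l p" "adjacent E p l" "p \<noteq> l" "partner p = l"
    using partner[OF lM] by (simp_all add: p_def)
  have lW: "l \<in> W" by fact
  have row_l: "(\<Sum>j | j \<in> W \<and> adjacent E l j. w j) = w p" for w :: "'v \<Rightarrow> int"
    using leaf(4) by (simp add: p_def)
  have row_p: "(\<Sum>j | j \<in> W \<and> adjacent E p j. w j) = w l + (\<Sum>j | j \<in> W' \<and> adjacent E p j. w j)" for w :: "'v \<Rightarrow> int"
  proof -
    have "{j. j \<in> W \<and> adjacent E p j} = insert l {j. j \<in> W' \<and> adjacent E p j}"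
      using p lW not_adjacent_self by (auto simp: W'_def)
    then show ?thesis using finW' by (simp add: W'_def)
  qed
  have nl: "\<not> adjacent E k l" if "k \<in> W'" for k
    using that leaf(4) adjacent_commute[of E] by (auto simp: W'_def p_def)
  have row: "(\<Sum>j | j \<in> W \<and> adjacent E k j. w j)
      = (if adjacent E k p then w p else 0) + (\<Sum>j | j \<in> W' \<and> adjacent E k j. w j)"
    if "k \<in> W'" for k and w :: "'v \<Rightarrow> int"
  proof -
    have "{j. j \<in> W \<and> adjacent E k j} = (if adjacent E k p then {p} else {}) \<union> {j. j \<in> W' \<and> adjacent E k j}"
      using p nl[OF that] by (auto simp: W'_def)
    then show ?thesis using finW' by (auto simp: W'_def)
  qed
  have WW': "W = insert l (insert p W')" using p lW by (auto simp: W'_def)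
  have cl: "c j = c l" if "adjacent E p j" for j using c[OF that] c[OF p(3)] by auto
  note IH = leaf(5)[folded p_def, folded W'_def]
  show ?case
  proof
    fix i assume "i \<in> W"
    then consider "i \<in> W'" | "i = l" | "i = p" using WW' by blast
    then show "\<exists>w. weights_on c W i w"
    proof cases
      case 1
      then obtain w' where "weights_on c W' i w'" using IH by blast
      note w' = weights_onD[OF this]
      \<comment> \<open>The row of \<open>l\<close> forces weight 0 at \<open>p\<close>, so the old
        rows are undisturbed; the value at \<open>l\<close> cancels the row of
        \<open>p\<close>.\<close>
      define w where "w = w' (l := - (\<Sum>j | j \<in> W' \<and> adjacent E p j. w' j))"
      have wp: "w p = 0" using w'(1)[of p] p by (auto simp: w_def W'_def)
      have sums: "(\<Sum>j | j \<in> W' \<and> adjacent E k j. w j) = (\<Sum>j | j \<in> W' \<and> adjacent E k j. w' j)" for k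
        by (intro sum.cong) (auto simp: w_def W'_def)
      show ?thesis
      proof (rule weights_onI[of w])
        show "k \<in> W" if "w k \<noteq> 0" for k
          using that w'(1)[of k] lW by (cases "k = l") (auto simp: w_def W'_def)
        show "c k \<noteq> c i" if "w k \<noteq> 0" for k
        proof (cases "k = l")
          case True
          then have "(\<Sum>j | j \<in> W' \<and> adjacent E p j. w' j) \<noteq> 0" using that by (simp add: w_def)
          then obtain j where "j \<in> {j. j \<in> W' \<and> adjacent E p j}" "w' j \<noteq> 0"
            by (rule sum.not_neutral_contains_not_neutral)
          then show ?thesis using w'(2)[of j] cl[of j] True by simp
        next
          case False
          then show ?thesis using that w'(2)[of k] by (simp add: w_def)
        qed
        have "partner i \<noteq> l" using w'(1)[of "partner i"] w'(3) by (auto simp: W'_def)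
        then show "w (partner i) = 1" using w'(3) by (simp add: w_def)
        fix k assume "k \<in> W"
        then consider "k \<in> W'" | "k = l" | "k = p" using WW' by blast
        then show "(\<Sum>l | l \<in> W \<and> adjacent E k l. w l) = (if k = i then 1 else 0)"
        proof cases
          case a: 1
          then show ?thesis using row[OF a, of w] wp sums w'(4) by simp
        next
          case 2
          then show ?thesis using row_l[of w] wp 1 by (auto simp: W'_def)
        next
          case 3
          then show ?thesis using row_p[of w] sums 1 by (auto simp: W'_def w_def)
        qed
      qed
    next
      case 2
      define K where "K = {k. k \<in> W' \<and> adjacent E p k}"
      have finK: "finite K" using finW' by (simp add: K_def)
      have "\<forall>i\<in>K. \<exists>u. weights_on c W' i u" using IH by (simp add: K_def)
      then obtain u where "\<forall>i\<in>K. weights_on c W' i (u i)" using bchoice[of K "weights_on c W'"] by blast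
      then have u: "weights_on c W' i (u i)" if "i \<in> K" for i using that by blast
      \<comment> \<open>The row of \<open>l\<close> forces weight 1 at \<open>p\<close>, which adds
        1 to the rows of the other neighbours \<open>K\<close> of \<open>p\<close>. Subtracting the
        solutions for these rows repairs them. By the colouring the solutions vanish at all
        neighbours of \<open>p\<close>, so the row of \<open>p\<close> is 0 with
        \<open>w l = 0\<close>.\<close>
      define w where "w k = (if k = p then 1 else - (\<Sum>i\<in>K. u i k))" for k
      have uz: "u i k = 0" if "i \<in> K" "c k = c l \<or> k \<notin> W'" for i k
        using weights_onD(1,2)[OF u[OF that(1)], of k] that cl[of i] by (auto simp: K_def)
      have wl: "w l = 0" using uz[of _ l] p by (simp add: w_def)
      show ?thesis
      proof (rule weights_onI[of w])
        have nz: "k = p \<or> k \<in> W' \<and> c k \<noteq> c l" if "w k \<noteq> 0" for k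
        proof (cases "k = p")
          case False
          then have "(\<Sum>i\<in>K. u i k) \<noteq> 0" using that by (simp add: w_def)
          then obtain j where "j \<in> K" "u j k \<noteq> 0" by (rule sum.not_neutral_contains_not_neutral)
          then show ?thesis using uz[of j k] by blast
        qed simp
        show "k \<in> W" if "w k \<noteq> 0" for k using nz[OF that] p by (auto simp: W'_def)
        show "c k \<noteq> c i" if "w k \<noteq> 0" for k using nz[OF that] c[OF p(3)] 2 by auto
        show "w (partner i) = 1" using 2 by (simp add: w_def p_def)
        have sums: "(\<Sum>j | j \<in> W' \<and> adjacent E k j. w j) = - (\<Sum>i\<in>K. \<Sum>j | j \<in> W' \<and> adjacent E k j. u i j)" for k
        proof -
          have "(\<Sum>j | j \<in> W' \<and> adjacent E k j. w j) = (\<Sum>j | j \<in> W' \<and> adjacent E k j. - (\<Sum>i\<in>K. u i j))"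
            by (intro sum.cong) (auto simp: w_def W'_def)
          also have "\<dots> = - (\<Sum>i\<in>K. \<Sum>j | j \<in> W' \<and> adjacent E k j. u i j)"
            by (simp add: sum_negf sum.swap[of _ K])
          finally show ?thesis .
        qed
        fix k assume "k \<in> W"
        then consider "k \<in> W'" | "k = l" | "k = p" using WW' by blast
        then show "(\<Sum>l | l \<in> W \<and> adjacent E k l. w l) = (if k = i then 1 else 0)"
        proof cases
          case a: 1
          have "(\<Sum>i\<in>K. \<Sum>j | j \<in> W' \<and> adjacent E k j. u i j) = (\<Sum>i\<in>K. if k = i then 1 else 0)"
            by (intro sum.cong refl weights_onD(4)[OF u a])
          also have "\<dots> = (if k \<in> K then 1 else 0)" using finK by (simp add: sum.delta)
          finally have "(\<Sum>i\<in>K. \<Sum>j | j \<in> W' \<and> adjacent E k j. u i j) = (if k \<in> K then 1 else 0)" .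
          then show ?thesis using row[OF a, of w] sums[of k] a 2 adjacent_commute[of E k p]
            by (auto simp: K_def w_def W'_def)
        next
          case b: 2
          then show ?thesis using row_l[of w] 2 by (simp add: w_def)
        next
          case b: 3
          have "(\<Sum>i\<in>K. \<Sum>j | j \<in> W' \<and> adjacent E p j. u i j) = 0"
            using cl uz by (intro sum.neutral ballI) auto
          then show ?thesis using b row_p[of w] wl sums[of p] p 2 by simp
        qed
      qed
    next
      case 3
      \<comment> \<open>The unit vector at \<open>l\<close> works, as \<open>p\<close> is the only
        neighbour of \<open>l\<close>.\<close>
      define w where "w k = (if k = l then 1 else (0::int))" for k
      have z: "(\<Sum>j | j \<in> W' \<and> adjacent E k j. w j) = 0" for k
        by (intro sum.neutral) (auto simp: w_def W'_def)
      show ?thesis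
      proof (rule weights_onI[of w])
        show "k \<in> W" "c k \<noteq> c i" if "w k \<noteq> 0" for k
          using that lW c[OF p(2)] 3 by (cases "k = l"; simp add: w_def)+
        show "w (partner i) = 1" using 3 p by (simp add: w_def)
        fix k assume "k \<in> W"
        then consider "k \<in> W'" | "k = l" | "k = p" using WW' by blast
        then show "(\<Sum>l | l \<in> W \<and> adjacent E k l. w l) = (if k = i then 1 else 0)"
        proof cases
          case a: 1
          then show ?thesis using row[OF a, of w] z 3 p by (auto simp: w_def W'_def)
        next
          case b: 2
          then show ?thesis using row_l[of w] 3 p by (simp add: w_def)
        next
          case b: 3
          then show ?thesis using row_p[of w] 3 z by (simp add: w_def)
        qed
      qed
    qed
  qed
qed simp

lemma exists_weights:
  assumes "i \<in> \<Union> M"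
  obtains w :: "'v \<Rightarrow> int" where "w i = 0" "w (partner i) = 1"
    "\<And>k. k \<in> \<Union> M \<Longrightarrow> (\<Sum>l\<in>nbs k. w l) = (if k = i then 1 else 0)"
proof -
  obtain c :: "'v \<Rightarrow> bool" where c: "\<And>u v. adjacent E u v \<Longrightarrow> c u \<noteq> c v" using two_coloring by blast
  have "partner ` \<Union> M \<subseteq> \<Union> M" using partner(1) by blast
  from matched_weights[where c = c, OF subset_refl this c] assms obtain w where "weights_on c (\<Union> M) i w" by blast
  note w = weights_onD[OF this]
  show ?thesis
  proof (rule that)
    show "w i = 0" using w(2)[of i] by blast
    show "w (partner i) = 1" by (rule w(3))
    show "(\<Sum>l\<in>nbs k. w l) = (if k = i then 1 else 0)" if k: "k \<in> \<Union> M" for k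
    proof -
      have "(\<Sum>l\<in>nbs k. w l) = (\<Sum>l | l \<in> \<Union> M \<and> adjacent E k l. w l)"
        using finite_vertices matched_vertices w(1) by (intro sum.mono_neutral_right) auto
      then show ?thesis using w(4)[OF k] by simp
    qed
  qed
qed

text \<open>The multiplicative form of injectivity, to be applied to the quotient of two solutions.
  For a leaf \<open>l\<close> with partner \<open>p\<close>, one of the two lies in
  \<open>S\<close>: either the equation at \<open>l\<close> or the normalization at \<open>p\<close>
  gives \<open>y p = 1\<close>. This leaves the equations on the smaller set intact, and after the
  induction \<open>y l = 1\<close> follows from normalization or from the equation at
  \<open>p\<close>.\<close>

lemma matched_product_unique:
  fixes y :: "'v \<Rightarrow> complex"
  assumes W: "W \<subseteq> \<Union> M" "partner ` W \<subseteq> W"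
    and S: "\<And>k. k \<in> \<Union> M \<Longrightarrow> k \<in> S \<or> partner k \<in> S"
    and y1: "\<And>k. k \<in> W \<Longrightarrow> k \<in> S \<Longrightarrow> y k = 1"
    and prod1: "\<And>k. k \<in> W \<Longrightarrow> k \<in> S \<Longrightarrow> (\<Prod>l | l \<in> W \<and> adjacent E k l. y l) = 1"
  shows "\<forall>k\<in>W. y k = 1"
  using W y1 prod1
proof (induction W rule: matched_leaf_induct)
  case (leaf W l)
  define p where "p = partner l"
  define W' where "W' = W - {l, p}"
  have finW: "finite W"
    by (rule finite_subset[OF subset_trans[OF leaf(1) matched_vertices] finite_vertices])
  then have finW': "finite W'" by (simp add: W'_def)
  have lM: "l \<in> \<Union> M" using leaf(1,3) by blast
  have "p \<in> W" using leaf(2,3) by (auto simp: p_def)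
  moreover have "adjacent E p l" using partner(3)[OF lM] by (simp add: p_def adjacent_commute[of E "partner l"])
  ultimately have p: "p \<in> W" "adjacent E l p" "adjacent E p l" "p \<noteq> l"
    using partner[OF lM] by (simp_all add: p_def)
  have lW: "l \<in> W" by fact
  have yp: "y p = 1"
  proof (cases "l \<in> S")
    case True
    then show ?thesis using leaf(7)[OF lW] leaf(4) by (simp add: p_def)
  next
    case False
    then show ?thesis using leaf(6)[of p] p S[OF lM] by (simp add: p_def)
  qed
  have nl: "\<not> adjacent E k l" if "k \<in> W'" for k
    using that leaf(4) adjacent_commute[of E] by (auto simp: W'_def p_def)
  have y': "\<forall>k\<in>W'. y k = 1"
    unfolding W'_def p_def
  proof (rule leaf(5), unfold p_def[symmetric], unfold W'_def[symmetric])
    show "y k = 1" if "k \<in> W'" "k \<in> S" for k using leaf(6) that by (simp add: W'_def)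
    show "(\<Prod>j | j \<in> W' \<and> adjacent E k j. y j) = 1" if k: "k \<in> W'" "k \<in> S" for k
    proof -
      have "(\<Prod>j | j \<in> W' \<and> adjacent E k j. y j) = (\<Prod>j | j \<in> W \<and> adjacent E k j. y j)"
        using finW yp nl[OF k(1)] by (intro prod.mono_neutral_left) (auto simp: W'_def)
      then show ?thesis using leaf(7)[of k] k by (simp add: W'_def)
    qed
  qed
  have "y l = 1"
  proof (cases "l \<in> S")
    case True
    then show ?thesis using leaf(6) lW by blast
  next
    case False
    then have "p \<in> S" using S[OF lM] by (simp add: p_def)
    then have "(\<Prod>j | j \<in> W \<and> adjacent E p j. y j) = 1" using leaf(7) p by blast
    moreover have "(\<Prod>j | j \<in> W \<and> adjacent E p j. y j) = (\<Prod>j\<in>{l}. y j)"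
      using finW y' lW p not_adjacent_self by (intro prod.mono_neutral_right) (auto simp: W'_def)
    ultimately show ?thesis by simp
  qed
  then show ?case using y' yp by (auto simp: W'_def)
qed simp

section \<open>Tight sets as the complements of minimum vertex covers\<close>

definition tight :: "'v set \<Rightarrow> bool" where
  "tight S \<longleftrightarrow> S \<subseteq> V \<and> (\<forall>u\<in>S. \<forall>v\<in>S. \<not> adjacent E u v) \<and>
     (\<forall>v\<in>V - \<Union> M. v \<in> S) \<and> (\<forall>v\<in>\<Union> M. v \<in> S \<or> partner v \<in> S)"

lemma finite_matching: "finite M"
  using matched_vertices finite_vertices by (intro finite_subset[of M "Pow V"]) auto

lemma edges: "e \<in> E \<longleftrightarrow> (\<exists>u v. e = {u, v} \<and> adjacent E u v)"
proof
  assume "e \<in> E"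
  then have "card e = 2" using graph by (auto simp: finite_graph_def)
  then show "\<exists>u v. e = {u, v} \<and> adjacent E u v"
    using \<open>e \<in> E\<close> by (auto simp: card_2_iff adjacent_def)
qed (auto simp: adjacent_def)

lemma cover_choice:
  assumes "vertex_cover V E C"
  obtains h where "inj_on h M" "\<And>e. e \<in> M \<Longrightarrow> h e \<in> C \<inter> e"
proof -
  have "\<forall>e\<in>M. \<exists>v. v \<in> C \<inter> e"
    using assms matching(1) by (auto simp: vertex_cover_def)
  then obtain h where h: "\<forall>e\<in>M. h e \<in> C \<inter> e" using bchoice[of M "\<lambda>e v. v \<in> C \<inter> e"] by blast
  have "inj_on h M"
  proof (rule inj_onI)
    fix e f assume ef: "e \<in> M" "f \<in> M" "h e = h f"
    then have "h e \<in> e" "h e \<in> f" using h by auto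
    then show "e = f" using matching(2)[of "h e" e f] ef matched_vertices by blast
  qed
  then show ?thesis using h that by blast
qed

lemma card_matching_le_cover:
  assumes "vertex_cover V E C"
  shows "card M \<le> card C"
proof -
  obtain h where h: "inj_on h M" "\<And>e. e \<in> M \<Longrightarrow> h e \<in> C \<inter> e" using cover_choice[OF assms] by blast
  have "finite C" using assms finite_vertices finite_subset by (auto simp: vertex_cover_def)
  then show ?thesis using card_inj_on_le[OF h(1), of C] h(2) by blast
qed

text \<open>By Koenig's theorem a minimum cover is no larger than \<open>M\<close>. As it needs a
  separate vertex for each edge of \<open>M\<close>, it consists of exactly one endpoint of each and
  of no unmatched vertex. Conversely, a cover of this shape has at most \<open>card M\<close>
  vertices, and no cover has fewer.\<close>

lemma minimum_vertex_cover_tight: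
  assumes C: "C \<subseteq> V"
  shows "minimum_vertex_cover V E C \<longleftrightarrow> tight (V - C)"
proof
  assume min: "minimum_vertex_cover V E C"
  then have cov: "vertex_cover V E C" by (simp add: minimum_vertex_cover_def)
  obtain N D where "matching_with_cover V N D"
    using exists_matching_with_cover[of V] by auto
  note ND = matching_with_coverD[OF this]
  have "vertex_cover V E D"
    unfolding vertex_cover_def
  proof (intro conjI ballI ND(3))
    fix e assume "e \<in> E"
    then obtain u v where "e = {u, v}" "adjacent E u v" using edges by blast
    then show "D \<inter> e \<noteq> {}" using ND(4) adjacent_vertices by blast
  qed
  then have "card C \<le> card D" using min by (simp add: minimum_vertex_cover_def)
  moreover have "matching V E N" using ND(1,2) unfolding matching_def by blast
  then have "card N \<le> card M" using maximum by (simp add: maximum_matching_def)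
  ultimately have le: "card C \<le> card M" using ND(5) by simp
  obtain h where h: "inj_on h M" "\<And>e. e \<in> M \<Longrightarrow> h e \<in> C \<inter> e" using cover_choice[OF cov] by blast
  have finC: "finite C" using C finite_vertices finite_subset by blast
  have "h ` M = C"
  proof (rule card_subset_eq[OF finC])
    show sub: "h ` M \<subseteq> C" using h(2) by blast
    show "card (h ` M) = card C"
      using le card_mono[OF finC sub] card_image[OF h(1)] by simp
  qed
  then have hC: "\<exists>e\<in>M. v = h e" if "v \<in> C" for v using that by (simp add: image_iff flip: \<open>h ` M = C\<close>)
  show "tight (V - C)"
    unfolding tight_def
  proof (intro conjI ballI)
    show "\<not> adjacent E u v" if "u \<in> V - C" "v \<in> V - C" for u v
      using that cov unfolding vertex_cover_def adjacent_def by fastforce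
    show "v \<in> V - C" if "v \<in> V - \<Union> M" for v
    proof (rule ccontr)
      assume "v \<notin> V - C"
      then have "v \<in> C" using that by blast
      then obtain e where "e \<in> M" "v = h e" using hC[of v] by auto
      then show False using that h(2)[of e] by auto
    qed
    show "v \<in> V - C \<or> partner v \<in> V - C" if v: "v \<in> \<Union> M" for v
    proof (rule ccontr)
      assume n: "\<not> ?thesis"
      have "v \<in> V" "partner v \<in> V" using v partner(1) matched_vertices by blast+
      then have "v \<in> C" "partner v \<in> C" using n by auto
      then obtain e f where ef: "e \<in> M" "v = h e" "f \<in> M" "partner v = h f"
        using hC[of v] hC[of "partner v"] by auto
      have "e = {v, partner v}"
        using matching(2)[of v e "{v, partner v}"] ef h(2)[of e] partner_edge[OF v] \<open>v \<in> V\<close> by auto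
      moreover have "f = {v, partner v}"
        using matching(2)[of "partner v" f "{v, partner v}"] ef h(2)[of f] partner_edge[OF v] \<open>partner v \<in> V\<close> by auto
      ultimately show False using ef partner(4)[OF v] by simp
    qed
  qed blast
next
  assume t: "tight (V - C)"
  have cov: "vertex_cover V E C"
    unfolding vertex_cover_def
  proof (intro conjI ballI C)
    fix e assume "e \<in> E"
    then obtain u v where "e = {u, v}" "adjacent E u v" using edges by blast
    then show "C \<inter> e \<noteq> {}" using t adjacent_vertices[of u v] unfolding tight_def by blast
  qed
  have CM: "C \<subseteq> \<Union> M" using t C unfolding tight_def by blast
  have "inj_on (\<lambda>v. {v, partner v}) C"
  proof (rule inj_onI)
    fix u v assume uv: "u \<in> C" "v \<in> C" "{u, partner u} = {v, partner v}"
    then have "u = v \<or> u = partner v" by auto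
    moreover have "partner v \<notin> C"
    proof -
      have "v \<in> \<Union> M" using uv(2) CM by auto
      moreover have "\<forall>v\<in>\<Union> M. v \<in> V - C \<or> partner v \<in> V - C"
        using t unfolding tight_def by (elim conjE)
      ultimately have "v \<in> V - C \<or> partner v \<in> V - C" by (rule bspec[rotated])
      then show ?thesis using uv(2) by auto
    qed
    ultimately show "u = v" using uv(1) by auto
  qed
  then have "card C \<le> card M"
    using CM partner_edge finite_matching by (intro card_inj_on_le[of "\<lambda>v. {v, partner v}"]) auto
  then show "minimum_vertex_cover V E C"
    unfolding minimum_vertex_cover_def
    by (intro conjI cov allI impI) (rule le_trans[OF _ card_matching_le_cover])
qed

lemma vc_tight: "vc V E = card {S. tight S}"
proof -
  have "bij_betw (\<lambda>C. V - C) {C. minimum_vertex_cover V E C} {S. tight S}"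
  proof (rule bij_betw_byWitness[where f' = "\<lambda>S. V - S"])
    have sub: "C \<subseteq> V" if "minimum_vertex_cover V E C" for C
      using that by (simp add: minimum_vertex_cover_def vertex_cover_def)
    have sub': "S \<subseteq> V" if "tight S" for S using that by (simp add: tight_def)
    show "\<forall>C\<in>{C. minimum_vertex_cover V E C}. V - (V - C) = C" using sub by blast
    show "\<forall>S\<in>{S. tight S}. V - (V - S) = S" using sub' by blast
    show "(\<lambda>C. V - C) ` {C. minimum_vertex_cover V E C} \<subseteq> {S. tight S}"
      using sub minimum_vertex_cover_tight by blast
    show "(\<lambda>S. V - S) ` {S. tight S} \<subseteq> {C. minimum_vertex_cover V E C}"
    proof
      fix C assume "C \<in> (\<lambda>S. V - S) ` {S. tight S}"
      then obtain S where S: "tight S" "C = V - S" by blast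
      then have "V - C = S" using sub' by blast
      then show "C \<in> {C. minimum_vertex_cover V E C}"
        using minimum_vertex_cover_tight[of C] S by blast
    qed
  qed
  then show ?thesis unfolding vc_def by (rule bij_betw_same_card)
qed

end

section \<open>The strata of the versal variety\<close>

lemma prod_power_int:
  fixes t :: "'a::field"
  assumes "t \<noteq> 0"
  shows "(\<Prod>j\<in>A. t powi (e j)) = t powi (\<Sum>j\<in>A. e j)"
  by (induction A rule: infinite_finite_induct) (simp_all add: power_int_add assms)

lemma continuous_on_snd_coordinate: "continuous_on S (\<lambda>p. snd p c)"
  by (rule continuous_on_product_then_coordinatewise[OF continuous_on_snd[OF continuous_on_id]])

lemma continuous_on_coordinate: "continuous_on S (\<lambda>z. z c)"
  by (rule continuous_on_product_then_coordinatewise[OF continuous_on_id])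

text \<open>Meant for affine spaces, so the parameter \<open>t\<close> ranges over all
  reals.\<close>

lemma set_ec_star:
  fixes A :: "('c \<Rightarrow> complex) set"
  assumes z0: "z0 \<in> A" and star: "\<And>z t. z \<in> A \<Longrightarrow> (\<lambda>c. z0 c + of_real t * (z c - z0 c)) \<in> A"
  shows "set_ec A 1"
proof -
  have "set_ec A 1 \<longleftrightarrow> set_ec {z0} 1"
  proof (rule set_ec_deformation[where r = "\<lambda>_. z0" and s = "\<lambda>_. z0" and
        h = "\<lambda>p c. z0 c + of_real (fst p) * (snd p c - z0 c)"])
    show "continuous_on ({0..1} \<times> A) (\<lambda>p c. z0 c + of_real (fst p) * (snd p c - z0 c))"
      by (rule continuous_on_coordinatewise_then_product) (intro continuous_intros continuous_on_snd_coordinate)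
    show "(\<lambda>p c. z0 c + of_real (fst p) * (snd p c - z0 c)) \<in> {0..1} \<times> A \<rightarrow> A"
      using star by auto
  qed (use z0 in auto)
  moreover have "set_ec {z0} 1" by (rule has_euler_characteristic_singleton[of _ z0]) simp
  ultimately show ?thesis by simp
qed

context matched_graph
begin

abbreviation coords :: "'v coord set" where "coords \<equiv> versal_coords V M"

lemma coords_iff [simp]: "Coord_x i \<in> coords \<longleftrightarrow> i \<in> V" "Coord_x' i \<in> coords \<longleftrightarrow> i \<in> V"
  "Coord_alpha i \<in> coords \<longleftrightarrow> i \<in> V \<and> i \<notin> \<Union> M"
  by (auto simp: versal_coords_def)

definition fmon :: "('v coord \<Rightarrow> complex) \<Rightarrow> 'v \<Rightarrow> complex" where
  "fmon z i = versal_alpha M z i * (\<Prod>j\<in>nbs i. z (Coord_x j))"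

lemma versal_equations_fmon: "versal_equations V E M z \<longleftrightarrow>
    (\<forall>i\<in>V. z (Coord_x i) * z (Coord_x' i) = 1 + fmon z i) \<and> (\<forall>i\<in>V - \<Union> M. z (Coord_alpha i) \<noteq> 0)"
  by (simp add: versal_equations_def fmon_def)

lemma fmon_cong:
  assumes "\<And>j. j \<in> nbs i \<Longrightarrow> z (Coord_x j) = z' (Coord_x j)" "z (Coord_alpha i) = z' (Coord_alpha i)"
  shows "fmon z i = fmon z' i"
  unfolding fmon_def versal_alpha_def using assms by (auto intro!: prod.cong)

lemma fmon_nonzero:
  assumes "fmon z i \<noteq> 0" "j \<in> nbs i"
  shows "z (Coord_x j) \<noteq> 0"
  using assms finite_vertices by (auto simp: fmon_def)

lemma continuous_on_fmon:
  assumes "\<And>c. continuous_on S (\<lambda>w. g w c)"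
  shows "continuous_on S (\<lambda>w. fmon (g w) i)"
  unfolding fmon_def versal_alpha_def by (cases "i \<in> \<Union> M") (simp_all add: assms continuous_intros)

text \<open>The coordinates x'_k occur in none of the f_i, so overwriting one affects only the
  equation at its own vertex.\<close>

definition upd_x' :: "'v set \<Rightarrow> ('v \<Rightarrow> complex) \<Rightarrow> ('v coord \<Rightarrow> complex) \<Rightarrow> 'v coord \<Rightarrow> complex" where
  "upd_x' J h z = (\<lambda>c. case c of Coord_x' k \<Rightarrow> if k \<in> J then h k else z c | _ \<Rightarrow> z c)"

lemma upd_x'_simps [simp]:
  "upd_x' J h z (Coord_x k) = z (Coord_x k)"
  "upd_x' J h z (Coord_alpha k) = z (Coord_alpha k)"
  "upd_x' J h z (Coord_x' k) = (if k \<in> J then h k else z (Coord_x' k))"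
  by (simp_all add: upd_x'_def)

lemma fmon_upd_x' [simp]: "fmon (upd_x' J h z) i = fmon z i"
  by (rule fmon_cong) simp_all

lemma upd_x'_extensional: "z \<in> extensional coords \<Longrightarrow> J \<subseteq> V \<Longrightarrow> upd_x' J h z \<in> extensional coords"
  unfolding extensional_def upd_x'_def by (auto split: coord.splits)

lemma continuous_on_upd_x':
  assumes "\<And>k. k \<in> J \<Longrightarrow> continuous_on S (\<lambda>w. h w k)" "\<And>c. continuous_on S (\<lambda>w. g w c)"
  shows "continuous_on S (\<lambda>w. upd_x' J (h w) (g w))"
proof (rule continuous_on_coordinatewise_then_product)
  show "continuous_on S (\<lambda>w. upd_x' J (h w) (g w) c)" for c
  proof (cases c)
    case (Coord_x' k)
    then show ?thesis by (cases "k \<in> J") (simp_all add: assms)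
  qed (simp_all add: assms)
qed

section \<open>One-parameter actions on the coordinates\<close>

definition torus_act :: "('v coord \<Rightarrow> int) \<Rightarrow> complex \<Rightarrow> ('v coord \<Rightarrow> complex) \<Rightarrow> 'v coord \<Rightarrow> complex" where
  "torus_act e t z = (\<lambda>c. if c \<in> coords then t powi (e c) * z c else undefined)"

lemma torus_act_coord [simp]: "c \<in> coords \<Longrightarrow> torus_act e t z c = t powi (e c) * z c"
  by (simp add: torus_act_def)

lemma torus_act_extensional [simp]: "torus_act e t z \<in> extensional coords"
  by (simp add: torus_act_def extensional_def)

lemma torus_act_1: "z \<in> extensional coords \<Longrightarrow> torus_act e 1 z = z"
  by (auto simp: torus_act_def extensional_def)

lemma torus_act_mult: "torus_act e s (torus_act e t z) = torus_act e (s * t) z"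
  by (auto simp: torus_act_def power_int_mult_distrib)

lemma continuous_on_torus_act_coord:
  assumes "continuous_on S f" "\<And>w. w \<in> S \<Longrightarrow> f w \<noteq> 0" "\<And>c. continuous_on S (\<lambda>w. g w c)"
  shows "continuous_on S (\<lambda>w. torus_act e (f w) (g w) c)"
  unfolding torus_act_def by (cases "c \<in> coords") (use assms in \<open>auto intro!: continuous_intros\<close>)

lemma continuous_on_torus_act:
  "continuous_on ((- {0}) \<times> Y) (\<lambda>p. torus_act e (fst p) (snd p))"
  by (rule continuous_on_coordinatewise_then_product, rule continuous_on_torus_act_coord)
     (auto intro: continuous_on_fst continuous_on_id continuous_on_snd_coordinate)

text \<open>
  The weights of a one-parameter group that multiplies \<open>f\<^sub>i\<close> by its parameter and fixes \<open>x\<^sub>i\<close> and the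
  other \<open>f\<^sub>k\<close>; the last condition gives a coordinate of weight \<open>1\<close>.
\<close>

definition exponents :: "'v \<Rightarrow> ('v coord \<Rightarrow> int) \<Rightarrow> bool" where
  "exponents i e \<longleftrightarrow>
     (\<forall>k. e (Coord_x' k) = - e (Coord_x k)) \<and> e (Coord_x i) = 0 \<and>
     (\<forall>k\<in>V. (if k \<in> \<Union> M then 0 else e (Coord_alpha k)) + (\<Sum>l\<in>nbs k. e (Coord_x l)) = (if k = i then 1 else 0)) \<and>
     (if i \<in> \<Union> M then e (Coord_x (partner i)) = 1 else e (Coord_alpha i) = 1)"

text \<open>For a matched vertex the weights of the x_k come from the inverse adjacency matrix, and
  the weight of alpha_k at an unmatched vertex compensates for what happens to f_k there. For an
  unmatched vertex it suffices to scale alpha_i.\<close>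

lemma exists_exponents:
  obtains e where "exponents i e"
proof (cases "i \<in> \<Union> M")
  case True
  then obtain w :: "'v \<Rightarrow> int" where w: "w i = 0" "w (partner i) = 1"
    "\<And>k. k \<in> \<Union> M \<Longrightarrow> (\<Sum>l\<in>nbs k. w l) = (if k = i then 1 else 0)"
    using exists_weights by metis
  define e where "e c = (case c of Coord_x k \<Rightarrow> w k | Coord_x' k \<Rightarrow> - w k |
     Coord_alpha k \<Rightarrow> - (\<Sum>l\<in>nbs k. w l))" for c
  have "exponents i e" unfolding exponents_def using w True by (auto simp: e_def)
  then show ?thesis by (rule that)
next
  case False
  define e where "e c = (if c = Coord_alpha i then 1 else (0::int))" for c
  have "exponents i e" unfolding exponents_def using False by (auto simp: e_def)
  then show ?thesis by (rule that)
qed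

lemma fmon_torus_act:
  assumes e: "exponents i e" and k: "k \<in> V" and t: "t \<noteq> 0"
  shows "fmon (torus_act e t z) k = (if k = i then t else 1) * fmon z k"
proof -
  have "(\<Prod>j\<in>nbs k. torus_act e t z (Coord_x j)) = (\<Prod>j\<in>nbs k. t powi e (Coord_x j)) * (\<Prod>j\<in>nbs k. z (Coord_x j))"
    by (simp flip: prod.distrib)
  also have "(\<Prod>j\<in>nbs k. t powi e (Coord_x j)) = t powi (\<Sum>j\<in>nbs k. e (Coord_x j))"
    by (rule prod_power_int[OF t])
  finally have "fmon (torus_act e t z) k =
     t powi ((if k \<in> \<Union> M then 0 else e (Coord_alpha k)) + (\<Sum>l\<in>nbs k. e (Coord_x l))) * fmon z k"
    using k t unfolding fmon_def versal_alpha_def by (simp add: power_int_add)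
  also have "(if k \<in> \<Union> M then 0 else e (Coord_alpha k)) + (\<Sum>l\<in>nbs k. e (Coord_x l)) = (if k = i then 1 else 0)"
    using e k unfolding exponents_def by blast
  finally show ?thesis by simp
qed

text \<open>\<open>A\<close> holds the vertices at which vanishing of x_i has been decided.
  \<open>stratum {} {}\<close> is the whole variety, \<open>stratum V S\<close> a stratum of the
  overview, and the sets in between allow one divisor to be cut at a time.\<close>

definition stratum :: "'v set \<Rightarrow> 'v set \<Rightarrow> ('v coord \<Rightarrow> complex) set" where
  "stratum A S = {z \<in> extensional coords. versal_equations V E M z \<and>
     (\<forall>i\<in>S. z (Coord_x i) = 0) \<and> (\<forall>i\<in>A - S. z (Coord_x i) \<noteq> 0)}"

text \<open>
  Setting \<open>x\<^sub>i = u\<close> and \<open>x'\<^sub>i = v\<close> requires \<open>f\<^sub>i = u v - 1\<close>, which the action achieves; the new value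
  of \<open>x\<^sub>i\<close> breaks the equations of the neighbours \<open>j\<close> of \<open>i\<close>, but near the divisor \<open>f\<^sub>i \<noteq> 0\<close>, hence
  \<open>x\<^sub>j \<noteq> 0\<close>, and \<open>x'\<^sub>j\<close> can be recomputed.
\<close>

definition divisor_move ::
    "'v \<Rightarrow> ('v coord \<Rightarrow> int) \<Rightarrow> complex \<Rightarrow> complex \<Rightarrow> ('v coord \<Rightarrow> complex) \<Rightarrow> 'v coord \<Rightarrow> complex" where
  "divisor_move i e u v z =
     (torus_act e ((1 - u * v) / (1 - z (Coord_x i) * z (Coord_x' i))) z) (Coord_x i := u, Coord_x' i := v)"

definition divisor_map ::
    "'v \<Rightarrow> ('v coord \<Rightarrow> int) \<Rightarrow> complex \<Rightarrow> complex \<Rightarrow> ('v coord \<Rightarrow> complex) \<Rightarrow> 'v coord \<Rightarrow> complex" where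
  "divisor_map i e u v z =
     (let z' = divisor_move i e u v z in
      upd_x' (nbs i) (\<lambda>j. (1 + fmon z' j) / z' (Coord_x j)) z')"

lemma stratum_eq: "z \<in> stratum A S \<Longrightarrow> i \<in> V \<Longrightarrow> z (Coord_x i) * z (Coord_x' i) = 1 + fmon z i"
  by (simp add: stratum_def versal_equations_fmon)

lemma norm_less_1_diff: "norm (w :: complex) < 1 \<Longrightarrow> 1 - w \<noteq> 0"
  by auto

section \<open>A product neighbourhood of a single divisor\<close>

context
  fixes i :: 'v and e :: "'v coord \<Rightarrow> int" and A S :: "'v set" and N :: "('v coord \<Rightarrow> complex) set"
  assumes i: "i \<in> V" "i \<notin> A" and SA: "S \<subseteq> A" "A \<subseteq> V" and e: "exponents i e"
  defines "N \<equiv> {z \<in> stratum A S. norm (z (Coord_x i) * z (Coord_x' i)) < 1}"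
begin

text \<open>The parameter of the action in \<open>divisor_move\<close> is the quotient of the new
  and the old value of f_i, where f_i = x_i x'_i - 1. The neighbours \<open>k\<close> of
  \<open>i\<close> are excluded because overwriting x_i changes f_k.\<close>

lemma fmon_move:
  assumes "k \<in> V" "norm (u * v) < 1" "z \<in> N" "i \<notin> nbs k"
  shows "fmon (divisor_move i e u v z) k = (if k = i then u * v - 1 else fmon z k)"
proof -
  define t where "t = (1 - u * v) / (1 - z (Coord_x i) * z (Coord_x' i))"
  have d: "1 - z (Coord_x i) * z (Coord_x' i) \<noteq> 0" "1 - u * v \<noteq> 0"
    using assms norm_less_1_diff by (auto simp: N_def)
  then have t: "t \<noteq> 0" by (simp add: t_def)
  have "fmon (divisor_move i e u v z) k = fmon (torus_act e t z) k"
    using assms(4) by (intro fmon_cong) (auto simp: divisor_move_def t_def)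
  also have "\<dots> = (if k = i then t else 1) * fmon z k"
    by (rule fmon_torus_act[OF e assms(1) t])
  also have "\<dots> = (if k = i then u * v - 1 else fmon z k)"
  proof (cases "k = i")
    case True
    define b where "b = 1 - z (Coord_x i) * z (Coord_x' i)"
    have "fmon z i = - b"
      using stratum_eq[of z A S i] assms i by (simp add: N_def b_def)
    moreover have "t = (1 - u * v) / b" "b \<noteq> 0" using d by (simp_all add: t_def b_def)
    ultimately show ?thesis using True by simp
  qed simp
  finally show ?thesis .
qed

lemma nbs_not_self: "i \<notin> nbs i"
  using not_adjacent_self by simp

lemma move_nonzero:
  assumes "norm (u * v) < 1" "z \<in> N" "j \<in> nbs i"
  shows "divisor_move i e u v z (Coord_x j) \<noteq> 0"
proof (rule fmon_nonzero[OF _ assms(3)])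
  show "fmon (divisor_move i e u v z) i \<noteq> 0"
    using fmon_move[OF i(1) assms(1,2) nbs_not_self] norm_less_1_diff[OF assms(1)] by simp
qed

lemma divisor_map_coords:
  "divisor_map i e u v z (Coord_x i) = u" "divisor_map i e u v z (Coord_x' i) = v"
  using nbs_not_self by (auto simp: divisor_map_def Let_def divisor_move_def)

text \<open>At neighbours of \<open>i\<close> the equation holds by the choice of x'_k, at
  \<open>i\<close> by the choice of the parameter. At all other vertices both sides are invariant,
  since x_k and x'_k have opposite weights.\<close>

lemma divisor_map_stratum:
  assumes uv: "norm (u * v) < 1" and z: "z \<in> N"
  shows "divisor_map i e u v z \<in> stratum A S"
proof -
  let ?z' = "divisor_move i e u v z"
  define t where "t = (1 - u * v) / (1 - z (Coord_x i) * z (Coord_x' i))"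
  have d: "1 - z (Coord_x i) * z (Coord_x' i) \<noteq> 0" "1 - u * v \<noteq> 0"
    using uv z norm_less_1_diff by (auto simp: N_def)
  then have t: "t \<noteq> 0" by (simp add: t_def)
  have zS: "z \<in> stratum A S" using z by (simp add: N_def)
  have ext: "divisor_map i e u v z \<in> extensional coords"
  proof -
    have "?z' \<in> extensional coords"
      using i by (auto simp: divisor_move_def torus_act_def extensional_def)
    then show ?thesis unfolding divisor_map_def Let_def by (intro upd_x'_extensional) auto
  qed
  have eqs: "divisor_map i e u v z (Coord_x k) * divisor_map i e u v z (Coord_x' k) = 1 + fmon (divisor_map i e u v z) k"
    if k: "k \<in> V" for k
  proof -
    consider "k \<in> nbs i" | "k = i" | "k \<notin> nbs i" "k \<noteq> i" by blast
    then show ?thesis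
    proof cases
      case 1
      then show ?thesis using move_nonzero[OF uv z 1] by (simp add: divisor_map_def Let_def)
    next
      case 2
      then show ?thesis using divisor_map_coords fmon_move[OF i(1) uv z nbs_not_self]
        by (simp add: divisor_map_def Let_def)
    next
      case 3
      then have "i \<notin> nbs k" using k adjacent_commute[of E] by auto
      then have "fmon (divisor_map i e u v z) k = fmon z k"
        using fmon_move[OF k uv z] 3 by (simp add: divisor_map_def Let_def)
      moreover have "divisor_map i e u v z (Coord_x k) * divisor_map i e u v z (Coord_x' k)
          = z (Coord_x k) * z (Coord_x' k)"
      proof -
        have "e (Coord_x' k) = - e (Coord_x k)" using e unfolding exponents_def by blast
        then show ?thesis
          using 3 k t by (simp add: divisor_map_def Let_def divisor_move_def t_def[symmetric] power_int_minus)
      qed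
      ultimately show ?thesis using stratum_eq[OF zS k] by simp
    qed
  qed
  have al: "divisor_map i e u v z (Coord_alpha k) \<noteq> 0" if "k \<in> V - \<Union> M" for k
    using zS that t by (auto simp: divisor_map_def Let_def divisor_move_def t_def[symmetric] stratum_def versal_equations_fmon)
  have x: "divisor_map i e u v z (Coord_x k) = 0 \<longleftrightarrow> z (Coord_x k) = 0" if "k \<in> A" for k
    using that i SA t by (auto simp: divisor_map_def Let_def divisor_move_def t_def[symmetric])
  show ?thesis
    unfolding stratum_def versal_equations_fmon
    using ext eqs al x zS SA by (auto simp: stratum_def)
qed

lemma divisor_map_id:
  assumes z: "z \<in> N"
  shows "divisor_map i e (z (Coord_x i)) (z (Coord_x' i)) z = z"
proof -
  have zS: "z \<in> stratum A S" and d: "1 - z (Coord_x i) * z (Coord_x' i) \<noteq> 0"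
    and uv: "norm (z (Coord_x i) * z (Coord_x' i)) < 1"
    using z norm_less_1_diff by (auto simp: N_def)
  have "z \<in> extensional coords" using zS by (simp add: stratum_def)
  then have mv: "divisor_move i e (z (Coord_x i)) (z (Coord_x' i)) z = z"
    using d by (simp add: divisor_move_def torus_act_1)
  show ?thesis
  proof
    fix c
    show "divisor_map i e (z (Coord_x i)) (z (Coord_x' i)) z c = z c"
    proof (cases c)
      case (Coord_x' k)
      show ?thesis
      proof (cases "k \<in> nbs i")
        case True
        then have "z (Coord_x k) \<noteq> 0" using move_nonzero[OF uv z True] mv by simp
        then show ?thesis using stratum_eq[OF zS, of k] True Coord_x'
          by (simp add: divisor_map_def mv field_simps)
      qed (auto simp: divisor_map_def mv Coord_x')
    qed (simp_all add: divisor_map_def mv)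
  qed
qed

text \<open>The parameters of two successive actions multiply and the factor 1 - u' v'
  cancels.\<close>

lemma divisor_map_map:
  assumes uv: "norm (u * v) < 1" and uv': "norm (u' * v') < 1" and z: "z \<in> N"
  shows "divisor_map i e u v (divisor_map i e u' v' z) = divisor_map i e u v z"
proof -
  define y where "y = divisor_map i e u' v' z"
  have d: "1 - z (Coord_x i) * z (Coord_x' i) \<noteq> 0" "1 - u * v \<noteq> 0" "1 - u' * v' \<noteq> 0"
    using uv uv' z norm_less_1_diff by (auto simp: N_def)
  \<comment> \<open>The excluded coordinates, x'_k at neighbours of \<open>i\<close>, are recomputed
    by the outer map anyway.\<close>
  have co: "divisor_move i e u v y c = divisor_move i e u v z c" if c: "\<And>k. k \<in> nbs i \<Longrightarrow> c \<noteq> Coord_x' k" for c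
  proof (cases "c = Coord_x i \<or> c = Coord_x' i \<or> c \<notin> coords")
    case True
    then show ?thesis by (auto simp: divisor_move_def torus_act_def)
  next
    case False
    have "y c = divisor_move i e u' v' z c"
      using c by (cases c) (auto simp: y_def divisor_map_def Let_def)
    also have "\<dots> = torus_act e ((1 - u' * v') / (1 - z (Coord_x i) * z (Coord_x' i))) z c"
      using False by (simp add: divisor_move_def)
    finally have "divisor_move i e u v y c = torus_act e ((1 - u * v) / (1 - u' * v'))
        (torus_act e ((1 - u' * v') / (1 - z (Coord_x i) * z (Coord_x' i))) z) c"
      using False by (simp add: divisor_move_def y_def divisor_map_coords)
    also have "\<dots> = torus_act e ((1 - u * v) / (1 - z (Coord_x i) * z (Coord_x' i))) z c"
      using d by (simp add: torus_act_mult)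
    finally show ?thesis using False by (simp add: divisor_move_def)
  qed
  have f: "fmon (divisor_move i e u v y) k = fmon (divisor_move i e u v z) k" for k
    by (rule fmon_cong) (simp_all add: co)
  have "divisor_map i e u v y c = divisor_map i e u v z c" for c
  proof (cases c)
    case (Coord_x' k)
    show ?thesis
    proof (cases "k \<in> nbs i")
      case True
      then show ?thesis unfolding Coord_x' divisor_map_def Let_def upd_x'_simps f by (simp add: co)
    next
      case False
      then have "divisor_move i e u v y (Coord_x' k) = divisor_move i e u v z (Coord_x' k)" by (intro co) auto
      then show ?thesis unfolding Coord_x' divisor_map_def Let_def upd_x'_simps using False by argo
    qed
  qed (simp_all add: divisor_map_def Let_def co)
  then show ?thesis unfolding y_def by blast
qed

lemma continuous_on_divisor_map:
  "continuous_on ({(u, v). norm (u * v) < 1} \<times> N) (\<lambda>w. divisor_map i e (fst (fst w)) (snd (fst w)) (snd w))"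
proof -
  let ?D = "{(u, v). norm (u * v) < 1} \<times> N :: ((complex \<times> complex) \<times> _) set"
  note zc = continuous_on_snd_coordinate[of ?D]
  have mv: "continuous_on ?D (\<lambda>w. divisor_move i e (fst (fst w)) (snd (fst w)) (snd w) c)" for c
  proof -
    have "continuous_on ?D (\<lambda>w. torus_act e ((1 - fst (fst w) * snd (fst w)) /
        (1 - snd w (Coord_x i) * snd w (Coord_x' i))) (snd w) c)"
      by (intro continuous_on_torus_act_coord continuous_intros zc)
         (use norm_less_1_diff in \<open>auto simp: N_def\<close>)
    then show ?thesis
      unfolding divisor_move_def fun_upd_apply
      by (cases "c = Coord_x i"; cases "c = Coord_x' i") (auto intro!: continuous_intros)
  qed
  show ?thesis
    unfolding divisor_map_def Let_def
    by (intro continuous_on_upd_x' continuous_intros continuous_on_fmon mv)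
       (use move_nonzero in auto)
qed

lemma set_ec_stratum_step:
  assumes "set_ec (stratum (insert i A) S) a" "set_ec (stratum (insert i A) (insert i S)) b"
  shows "set_ec (stratum A S) (a + b)"
proof (rule set_ec_divisor[where p = "\<lambda>z. z (Coord_x i)" and q = "\<lambda>z. z (Coord_x' i)" and D = "divisor_map i e"])
  show "continuous_on (stratum A S) (\<lambda>z. z (Coord_x i))" "continuous_on (stratum A S) (\<lambda>z. z (Coord_x' i))"
    by (rule continuous_on_coordinate)+
  have "stratum (insert i A) S = {z \<in> stratum A S. z (Coord_x i) \<noteq> 0}"
    using i SA by (auto simp: stratum_def)
  then show "set_ec {z \<in> stratum A S. z (Coord_x i) \<noteq> 0} a" using assms(1) by simp
  have "stratum (insert i A) (insert i S) = {z \<in> stratum A S. z (Coord_x i) = 0}"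
    using i SA by (auto simp: stratum_def)
  then show "set_ec {z \<in> stratum A S. z (Coord_x i) = 0} b" using assms(2) by simp
qed (use continuous_on_divisor_map divisor_map_stratum divisor_map_coords divisor_map_id divisor_map_map
     in \<open>auto simp: N_def\<close>)

end

text \<open>
  The stratum \<open>stratum V S\<close>, with the redundant coordinates \<open>x'\<^sub>k\<close> for \<open>k \<notin> S\<close> replaced by \<open>0\<close>
  and only the equations of the vertices in \<open>R \<subseteq> S\<close> imposed.
\<close>

definition torus_part :: "'v set \<Rightarrow> 'v set \<Rightarrow> ('v coord \<Rightarrow> complex) set" where
  "torus_part S R = {z \<in> extensional coords.
     (\<forall>k\<in>S. z (Coord_x k) = 0) \<and> (\<forall>k\<in>V - S. z (Coord_x k) \<noteq> 0 \<and> z (Coord_x' k) = 0) \<and>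
     (\<forall>k\<in>V - \<Union> M. z (Coord_alpha k) \<noteq> 0) \<and> (\<forall>k\<in>R. fmon z k = - 1)}"

text \<open>Outside \<open>S\<close> the equation can be solved for x'_k, since x_k is nonzero. On
  \<open>S\<close> it says f_k = -1 and leaves x'_k free.\<close>

lemma set_ec_stratum_torus_part:
  assumes S: "S \<subseteq> V"
  shows "set_ec (stratum V S) k \<longleftrightarrow> set_ec (torus_part S S) k"
proof (rule set_ec_homeomorphic[where r = "upd_x' (V - S) (\<lambda>_. 0)" and
      s = "\<lambda>z. upd_x' (V - S) (\<lambda>k. (1 + fmon z k) / z (Coord_x k)) z"])
  show "continuous_on (stratum V S) (upd_x' (V - S) (\<lambda>_. 0))"
    by (rule continuous_on_upd_x') (rule continuous_on_const continuous_on_coordinate)+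
  show "continuous_on (torus_part S S) (\<lambda>z. upd_x' (V - S) (\<lambda>k. (1 + fmon z k) / z (Coord_x k)) z)"
    by (intro continuous_on_upd_x' continuous_intros continuous_on_fmon continuous_on_coordinate)
       (auto simp: torus_part_def)
  have f: "fmon z k = - 1" if "z \<in> stratum V S" "k \<in> S" for z k
    using stratum_eq[OF that(1), of k] that S by (auto simp: stratum_def add_eq_0_iff)
  show "upd_x' (V - S) (\<lambda>_. 0) \<in> stratum V S \<rightarrow> torus_part S S"
  proof
    fix z assume z: "z \<in> stratum V S"
    then have "upd_x' (V - S) (\<lambda>_. 0) z \<in> extensional coords"
      by (intro upd_x'_extensional) (auto simp: stratum_def)
    then show "upd_x' (V - S) (\<lambda>_. 0) z \<in> torus_part S S"
      using z f[OF z] by (auto simp: torus_part_def stratum_def versal_equations_fmon)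
  qed
  show "(\<lambda>z. upd_x' (V - S) (\<lambda>k. (1 + fmon z k) / z (Coord_x k)) z) \<in> torus_part S S \<rightarrow> stratum V S"
  proof
    fix z assume z: "z \<in> torus_part S S"
    let ?w = "upd_x' (V - S) (\<lambda>k. (1 + fmon z k) / z (Coord_x k)) z"
    have "?w \<in> extensional coords"
      using z by (intro upd_x'_extensional) (auto simp: torus_part_def)
    moreover have "?w (Coord_x k) * ?w (Coord_x' k) = 1 + fmon ?w k" if "k \<in> V" for k
      using z that by (cases "k \<in> S") (auto simp: torus_part_def)
    ultimately show "?w \<in> stratum V S"
      using z by (auto simp: torus_part_def stratum_def versal_equations_fmon)
  qed
  show "upd_x' (V - S) (\<lambda>_. 0) (upd_x' (V - S) (\<lambda>k. (1 + fmon y k) / y (Coord_x k)) y) = y"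
    if y: "y \<in> torus_part S S" for y
  proof
    fix c
    show "upd_x' (V - S) (\<lambda>_. 0) (upd_x' (V - S) (\<lambda>k. (1 + fmon y k) / y (Coord_x k)) y) c = y c"
      using y by (cases c) (auto simp: torus_part_def)
  qed
  show "upd_x' (V - S) (\<lambda>k. (1 + fmon (upd_x' (V - S) (\<lambda>_. 0) x) k) / (upd_x' (V - S) (\<lambda>_. 0) x) (Coord_x k))
      (upd_x' (V - S) (\<lambda>_. 0) x) = x" if x: "x \<in> stratum V S" for x
  proof
    fix c
    show "upd_x' (V - S) (\<lambda>k. (1 + fmon (upd_x' (V - S) (\<lambda>_. 0) x) k) / (upd_x' (V - S) (\<lambda>_. 0) x) (Coord_x k))
      (upd_x' (V - S) (\<lambda>_. 0) x) c = x c"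
    proof (cases c)
      case (Coord_x' k)
      show ?thesis
      proof (cases "k \<in> V - S")
        case True
        then have "x (Coord_x k) \<noteq> 0" using x by (auto simp: stratum_def)
        then show ?thesis using stratum_eq[OF x, of k] True Coord_x' by (auto simp: field_simps)
      next
        case False
        then show ?thesis using Coord_x' by (auto simp only: upd_x'_simps if_False)
      qed
    qed simp_all
  qed
qed

section \<open>Equations and free torus factors on a full stratum\<close>

lemma torus_act_torus_part:
  assumes "z \<in> torus_part S R" "t \<noteq> 0" "S \<subseteq> V" "R \<subseteq> S"
    and "\<And>k. k \<in> R \<Longrightarrow> fmon (torus_act e t z) k = fmon z k"
  shows "torus_act e t z \<in> torus_part S R"
proof -
  have "z (Coord_x k) = 0" "k \<in> V" if "k \<in> S" for k using assms(1,3) that by (auto simp: torus_part_def)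
  then show ?thesis
    using assms by (auto simp: torus_part_def)
qed

lemma fmon_torus_part_nonzero:
  assumes "z \<in> torus_part S R" "i \<in> S" "S \<subseteq> V" "\<And>u v. u \<in> S \<Longrightarrow> v \<in> S \<Longrightarrow> \<not> adjacent E u v"
  shows "fmon z i \<noteq> 0"
  using assms finite_vertices by (auto simp: fmon_def versal_alpha_def torus_part_def)

text \<open>Imposing one more equation f_i = -1 is passing to a fibre of an equivariant map: the
  action scales f_i and preserves the equations already in \<open>R\<close>. Independence of
  \<open>S\<close> makes f_i nonzero.\<close>

lemma slice_equation:
  assumes i: "i \<in> S" "i \<notin> R" and S: "S \<subseteq> V" "R \<subseteq> S" "\<And>u v. u \<in> S \<Longrightarrow> v \<in> S \<Longrightarrow> \<not> adjacent E u v"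
    and e: "exponents i e"
  shows "slice (torus_part S R) (\<lambda>z. fmon z i) (torus_act e) (- 1)"
proof
  show "continuous_on (torus_part S R) (\<lambda>z. fmon z i)"
    by (intro continuous_on_fmon continuous_on_coordinate)
  show "fmon z i \<noteq> 0" if "z \<in> torus_part S R" for z
    using fmon_torus_part_nonzero[OF that i(1) S(1,3)] .
  show "torus_act e t z \<in> torus_part S R" if "t \<noteq> 0" "z \<in> torus_part S R" for t z
  proof (rule torus_act_torus_part[OF that(2,1) S(1,2)])
    show "fmon (torus_act e t z) k = fmon z k" if "k \<in> R" for k
    proof -
      have "k \<in> V" "k \<noteq> i" using that S i by auto
      then show ?thesis using fmon_torus_act[OF e _ \<open>t \<noteq> 0\<close>, of k z] by simp
    qed
  qed
  show "fmon (torus_act e t z) i = t * fmon z i" if "t \<noteq> 0" "z \<in> torus_part S R" for t z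
    using fmon_torus_act[OF e _ that(1), of i z] i S by auto
qed (auto simp: continuous_on_torus_act torus_act_mult torus_act_1 torus_part_def)

lemma torus_part_insert: "torus_part S (insert i R) = {z \<in> torus_part S R. fmon z i = - 1}"
  by (auto simp: torus_part_def)

lemma torus_part_nonempty:
  assumes S: "S \<subseteq> V" "R \<subseteq> S" "\<And>u v. u \<in> S \<Longrightarrow> v \<in> S \<Longrightarrow> \<not> adjacent E u v"
  shows "torus_part S R \<noteq> {}"
proof -
  have "finite R" using S finite_vertices by (meson finite_subset)
  then show ?thesis using S(2)
  proof (induction R rule: finite_induct)
    case empty
    define z :: "'v coord \<Rightarrow> complex" where "z c = (if c \<in> coords then case c of Coord_x k \<Rightarrow> if k \<in> S then 0 else 1 |
      Coord_x' k \<Rightarrow> 0 | Coord_alpha k \<Rightarrow> 1 else undefined)" for c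
    have "z \<in> torus_part S {}"
      using S(1) by (auto simp: torus_part_def z_def extensional_def)
    then show ?case by blast
  next
    case (insert i R)
    then obtain z where z: "z \<in> torus_part S R" by auto
    obtain e where e: "exponents i e" using exists_exponents by blast
    interpret slice "torus_part S R" "\<lambda>z. fmon z i" "torus_act e" "- 1"
      by (rule slice_equation) (use insert S e in auto)
    \<comment> \<open>The action moves any point to f_i = -1 without leaving the other
      equations.\<close>
    have "torus_act e (- 1 / fmon z i) z \<in> torus_part S (insert i R)"
      using T(2)[of "- 1 / fmon z i" z] gT[of "- 1 / fmon z i" z] g(2)[OF z] z by (simp add: torus_part_insert)
    then show ?case by blast
  qed
qed

text \<open>Without equations the set is a product of copies of C^*, with coordinates
  \<open>T\<close>, and an affine space of the x'_k with \<open>k\<close> in \<open>S\<close>.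
  Fixing all of \<open>T\<close> at 1 leaves the affine space; each coordinate released again
  contributes a factor C^*.\<close>

lemma set_ec_torus_part_empty: "S \<subseteq> V \<Longrightarrow> \<exists>k. set_ec (torus_part S {}) k"
proof -
  assume S: "S \<subseteq> V"
  define T where "T = Coord_x ` (V - S) \<union> Coord_alpha ` (V - \<Union> M)"
  have finT: "finite T" using finite_vertices by (simp add: T_def)
  define Q where "Q J = {z \<in> torus_part S {}. \<forall>c\<in>J. z c = 1}" for J
  have "\<exists>k. set_ec (Q J) k" if "J \<subseteq> T" for J
    using that
  proof (induction "card (T - J)" arbitrary: J)
    case 0
    then have J: "J = T" using finT by auto
    define z0 :: "'v coord \<Rightarrow> complex" where "z0 c = (if c \<in> coords then if c \<in> T then 1 else 0 else undefined)" for c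
    have "set_ec (Q J) 1"
    proof (rule set_ec_star[of z0])
      show "z0 \<in> Q J"
        using S by (auto simp: Q_def torus_part_def z0_def extensional_def J T_def)
      show "(\<lambda>c. z0 c + of_real t * (z c - z0 c)) \<in> Q J" if z: "z \<in> Q J" for z t
      proof -
        define w where "w = (\<lambda>c. z0 c + of_real t * (z c - z0 c))"
        have zt: "z \<in> torus_part S {}" and z1: "\<And>c. c \<in> T \<Longrightarrow> z c = 1" using z by (auto simp: Q_def J)
        have wT: "w c = z c" if "c \<in> T" for c
          using z1[OF that] that S by (auto simp: w_def z0_def T_def)
        moreover have "w c = undefined" if "c \<notin> coords" for c
          using zt that by (auto simp: w_def z0_def torus_part_def extensional_def)
        moreover have "w (Coord_x k) = 0" if "k \<in> S" for k
          using zt that S by (auto simp: w_def z0_def torus_part_def T_def)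
        moreover have "w (Coord_x k) = 1" if "k \<in> V - S" for k
          using wT[of "Coord_x k"] z1[of "Coord_x k"] that by (simp add: T_def)
        moreover have "w (Coord_x' k) = 0" if "k \<in> V - S" for k
          using zt that by (auto simp: w_def z0_def torus_part_def T_def)
        moreover have "w (Coord_alpha k) = 1" if "k \<in> V - \<Union> M" for k
          using wT[of "Coord_alpha k"] z1[of "Coord_alpha k"] that by (simp add: T_def)
        ultimately have "w \<in> Q J"
          unfolding Q_def J torus_part_def extensional_def using z1 by simp
        then show ?thesis by (simp add: w_def)
      qed
    qed
    then show ?case by blast
  next
    case (Suc n)
    then obtain c where c: "c \<in> T" "c \<notin> J"
      by (metis Diff_eq_empty_iff card.empty nat.distinct(1) subsetI)
    have "T - insert c J = (T - J) - {c}" by auto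
    then have "n = card (T - insert c J)" using Suc(2) c finT by simp
    then obtain k where k: "set_ec (Q (insert c J)) k" using Suc.hyps(1)[of "insert c J"] Suc.prems c by auto
    have cc: "c \<in> coords" using c by (auto simp: T_def)
    \<comment> \<open>No equation is imposed, so a single coordinate can be scaled alone.\<close>
    define e where "e d = (if d = c then 1 else (0::int))" for d
    interpret slice "Q J" "\<lambda>z. z c" "torus_act e" 1
    proof
      show "z c \<noteq> 0" if "z \<in> Q J" for z using that c by (auto simp: Q_def torus_part_def T_def)
      show "torus_act e t z \<in> Q J" if "t \<noteq> 0" "z \<in> Q J" for t z
      proof -
        have "torus_act e t z \<in> torus_part S {}"
          using that S by (intro torus_act_torus_part) (auto simp: Q_def)
        moreover have "torus_act e t z d = z d" if "d \<in> J" for d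
        proof -
          have "d \<in> coords" "d \<noteq> c" using that Suc.prems c by (auto simp: T_def)
          then show ?thesis by (simp add: e_def)
        qed
        ultimately show ?thesis using that by (simp add: Q_def)
      qed
      show "torus_act e t z c = t * z c" for t z using cc by (simp add: e_def)
    qed (auto simp: continuous_on_torus_act continuous_on_coordinate torus_act_mult torus_act_1 Q_def torus_part_def)
    have "Q (insert c J) = {z \<in> Q J. z c = 1}" by (auto simp: Q_def)
    then show ?case using set_ec_zero k by auto
  qed
  from this[of "{}"] show ?thesis by (simp add: Q_def)
qed

lemma set_ec_torus_part_exists:
  assumes S: "S \<subseteq> V" "R \<subseteq> S" "\<And>u v. u \<in> S \<Longrightarrow> v \<in> S \<Longrightarrow> \<not> adjacent E u v"
  shows "\<exists>k. set_ec (torus_part S R) k"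
proof -
  have "finite R" using S finite_vertices by (meson finite_subset)
  then show ?thesis using S(2)
  proof (induction R rule: finite_induct)
    case empty
    show ?case by (rule set_ec_torus_part_empty[OF S(1)])
  next
    case (insert i R)
    then obtain k where k: "set_ec (torus_part S R) k" by auto
    obtain e where e: "exponents i e" using exists_exponents by blast
    interpret slice "torus_part S R" "\<lambda>z. fmon z i" "torus_act e" "- 1"
      by (rule slice_equation) (use insert S e in auto)
    show ?case using set_ec_slice_exists[OF k] by (auto simp: torus_part_insert)
  qed
qed

text \<open>The action belonging to a vertex \<open>i\<close> that violates tightness changes only
  f_i, and \<open>i\<close> is not in \<open>S\<close>, so all imposed equations survive. The
  coordinate of weight 1, x at the partner or alpha_i, vanishes nowhere and splits off C^*.\<close>

lemma set_ec_torus_part_not_tight: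
  assumes S: "S \<subseteq> V" "\<And>u v. u \<in> S \<Longrightarrow> v \<in> S \<Longrightarrow> \<not> adjacent E u v" and nt: "\<not> tight S"
  shows "set_ec (torus_part S S) 0"
proof -
  obtain i where i: "i \<in> V" "i \<notin> S" "i \<in> \<Union> M \<longrightarrow> partner i \<notin> S"
    using nt S matched_vertices unfolding tight_def by blast
  obtain e where e: "exponents i e" using exists_exponents by blast
  define c where "c = (if i \<in> \<Union> M then Coord_x (partner i) else Coord_alpha i)"
  have c: "c \<in> coords" "e c = 1"
    using i e partner(1)[of i] matched_vertices by (auto simp: c_def exponents_def)
  interpret slice "torus_part S S" "\<lambda>z. z c" "torus_act e" 1
  proof
    show "z c \<noteq> 0" if "z \<in> torus_part S S" for z
      using that i partner(1)[of i] matched_vertices by (auto simp: c_def torus_part_def)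
    show "torus_act e t z \<in> torus_part S S" if "t \<noteq> 0" "z \<in> torus_part S S" for t z
    proof (rule torus_act_torus_part[OF that(2,1) S(1) order_refl])
      show "fmon (torus_act e t z) k = fmon z k" if "k \<in> S" for k
      proof -
        have "k \<in> V" "k \<noteq> i" using that S i by auto
        then show ?thesis using fmon_torus_act[OF e _ \<open>t \<noteq> 0\<close>, of k z] by simp
      qed
    qed
    show "torus_act e t z c = t * z c" for t z using c by simp
  qed (auto simp: continuous_on_torus_act continuous_on_coordinate torus_act_mult torus_act_1 torus_part_def)
  obtain k where "set_ec (torus_part S S) k" using set_ec_torus_part_exists[OF S(1) order_refl S(2)] by blast
  then show ?thesis using set_ec_slice_exists set_ec_zero by metis
qed

text \<open>All coordinates except the free x'_k are determined:
  \<open>matched_product_unique\<close>, applied to the quotients of the x_k, settles the x_k, and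
  f_k = -1 then gives alpha_k, because unmatched vertices lie in \<open>S\<close>.\<close>

lemma torus_part_tight_unique:
  assumes t: "tight S" and z: "z \<in> torus_part S S" "z' \<in> torus_part S S"
    and c: "\<And>k. k \<in> S \<Longrightarrow> c \<noteq> Coord_x' k"
  shows "z c = z' c"
proof -
  have S: "S \<subseteq> V" "\<And>u v. u \<in> S \<Longrightarrow> v \<in> S \<Longrightarrow> \<not> adjacent E u v" "\<And>v. v \<in> V \<Longrightarrow> v \<notin> \<Union> M \<Longrightarrow> v \<in> S"
    "\<And>v. v \<in> \<Union> M \<Longrightarrow> v \<in> S \<or> partner v \<in> S"
    using t unfolding tight_def by auto
  \<comment> \<open>On \<open>S\<close> both points have x_k = 0, so the quotient is replaced by 1
    there.\<close>
  define y where "y k = (if k \<in> S then 1 else z' (Coord_x k) / z (Coord_x k))" for k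
  have nb: "j \<in> V - S" "j \<in> \<Union> M" if "k \<in> S" "j \<in> nbs k" for k j
    using that S(2)[of k j] S(3)[of j] by auto
  have nz: "z (Coord_x j) \<noteq> 0" if "j \<in> V - S" for j using z(1) that by (simp add: torus_part_def)
  have nz': "fmon z k = - 1" "fmon z' k = - 1" if "k \<in> S" for k using z that by (simp_all add: torus_part_def)
  have pr: "(\<Prod>j\<in>nbs k. z' (Coord_x j)) = (\<Prod>j\<in>nbs k. z (Coord_x j)) * (\<Prod>j\<in>nbs k. y j)" if k: "k \<in> S" for k
    unfolding prod.distrib[symmetric]
    by (rule prod.cong) (use nb[OF k] nz in \<open>auto simp: y_def\<close>)
  have "\<forall>k\<in>\<Union> M. y k = 1"
  proof (rule matched_product_unique[where S = S])
    show "partner ` \<Union> M \<subseteq> \<Union> M" using partner(1) by blast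
    show "y k = 1" if "k \<in> S" for k using that by (simp add: y_def)
    show "(\<Prod>l | l \<in> \<Union> M \<and> adjacent E k l. y l) = 1" if k: "k \<in> \<Union> M" "k \<in> S" for k
    proof -
      have "{l. l \<in> \<Union> M \<and> adjacent E k l} = nbs k" using nb(2)[OF k(2)] matched_vertices by auto
      moreover have "fmon z k * (\<Prod>j\<in>nbs k. y j) = fmon z' k"
        using pr[OF k(2)] k(1) by (simp add: fmon_def versal_alpha_def)
      ultimately show ?thesis using nz'[OF k(2)] by simp
    qed
  qed (use S(4) in auto)
  then have y1: "y k = 1" if "k \<in> V" for k
    using S(3)[OF that] by (cases "k \<in> S") (simp add: y_def, blast)
  have x: "z (Coord_x k) = z' (Coord_x k)" if "k \<in> V" for k
  proof (cases "k \<in> S")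
    case True
    then show ?thesis using z by (simp add: torus_part_def)
  next
    case False
    then show ?thesis using y1[OF that] nz[of k] that by (simp add: y_def)
  qed
  show ?thesis
  proof (cases "c \<in> coords")
    case True
    show ?thesis
    proof (cases c)
      case (Coord_x k)
      then show ?thesis using x True by simp
    next
      case (Coord_x' k)
      then have "k \<in> V - S" using c True by auto
      then show ?thesis using z Coord_x' by (simp add: torus_part_def)
    next
      case (Coord_alpha k)
      then have k: "k \<in> V" "k \<notin> \<Union> M" using True by auto
      then have kS: "k \<in> S" using S(3) by blast
      have "(\<Prod>j\<in>nbs k. z (Coord_x j)) = (\<Prod>j\<in>nbs k. z' (Coord_x j))"
        by (rule prod.cong) (use x in auto)
      moreover have "fmon z k = fmon z' k" "fmon z k \<noteq> 0" using nz'[OF kS] by simp_all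
      ultimately show ?thesis using k Coord_alpha by (auto simp: fmon_def versal_alpha_def)
    qed
  next
    case False
    then show ?thesis using z by (simp add: torus_part_def extensional_def)
  qed
qed

text \<open>Two points differ only in the free coordinates x'_k with \<open>k\<close> in
  \<open>S\<close>, so the real line through them stays in the set.\<close>

lemma set_ec_torus_part_tight:
  assumes t: "tight S"
  shows "set_ec (torus_part S S) 1"
proof -
  have S: "S \<subseteq> V" "\<And>u v. u \<in> S \<Longrightarrow> v \<in> S \<Longrightarrow> \<not> adjacent E u v"
    using t unfolding tight_def by auto
  obtain z0 where z0: "z0 \<in> torus_part S S" using torus_part_nonempty[OF S(1) order_refl S(2)] by blast
  show ?thesis
  proof (rule set_ec_star[OF z0])
    fix z t assume z: "z \<in> torus_part S S"
    define w where "w = (\<lambda>c. z0 c + of_real t * (z c - z0 c))"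
    have w: "w c = z0 c" if "\<And>k. k \<in> S \<Longrightarrow> c \<noteq> Coord_x' k" for c
      using torus_part_tight_unique[OF assms z z0 that] by (simp add: w_def)
    have "fmon w k = fmon z0 k" for k
      by (rule fmon_cong) (use w in auto)
    moreover have "w c = undefined" if "c \<notin> coords" for c
    proof -
      have "w c = z0 c" using that S(1) by (intro w) auto
      then show ?thesis using z0 that by (simp add: torus_part_def extensional_def)
    qed
    moreover have "w (Coord_x k) = z0 (Coord_x k)" "w (Coord_alpha k) = z0 (Coord_alpha k)" for k
      by (intro w; simp)+
    moreover have "w (Coord_x' k) = z0 (Coord_x' k)" if "k \<in> V - S" for k
      by (rule w) (use that in auto)
    ultimately have "w \<in> torus_part S S"
      using z0 unfolding torus_part_def extensional_def by simp
    then show "(\<lambda>c. z0 c + of_real t * (z c - z0 c)) \<in> torus_part S S"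
      by (simp add: w_def)
  qed
qed

lemma set_ec_stratum_full:
  assumes S: "S \<subseteq> V"
  shows "set_ec (stratum V S) (if tight S then 1 else 0)"
proof (cases "\<exists>u\<in>S. \<exists>v\<in>S. adjacent E u v")
  case True
  then obtain u v where uv: "u \<in> S" "v \<in> S" "adjacent E u v" by blast
  have "z \<notin> stratum V S" for z
  proof
    assume z: "z \<in> stratum V S"
    have v: "v \<in> nbs u" using uv S by auto
    have "fmon z u = - 1" using stratum_eq[OF z, of u] uv S z by (auto simp: stratum_def add_eq_0_iff)
    then have "z (Coord_x v) \<noteq> 0" using fmon_nonzero[OF _ v, of z] by simp
    then show False using z uv by (simp add: stratum_def)
  qed
  then have "stratum V S = {}" by blast
  moreover have "\<not> tight S" using uv unfolding tight_def by blast
  ultimately show ?thesis by (simp add: has_euler_characteristic_empty)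
next
  case False
  then have "set_ec (torus_part S S) (if tight S then 1 else 0)"
    using set_ec_torus_part_tight[of S] set_ec_torus_part_not_tight[OF S] by simp
  then show ?thesis using set_ec_stratum_torus_part[OF S] by blast
qed

text \<open>Stated for all \<open>A\<close> so that one can induct on the number of undecided
  vertices. Cutting along x_i = 0 matches splitting the tight sets by whether they contain
  \<open>i\<close>.\<close>

lemma set_ec_stratum:
  assumes "S \<subseteq> A" "A \<subseteq> V"
  shows "set_ec (stratum A S) (int (card {S'. tight S' \<and> S' \<inter> A = S}))"
  using assms
proof (induction "card (V - A)" arbitrary: A S)
  case 0
  then have A: "A = V" using finite_vertices by auto
  have "S' \<inter> V = S'" if "tight S'" for S' using that unfolding tight_def by blast
  then have "{S'. tight S' \<and> S' \<inter> V = S} = (if tight S then {S} else {})"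
    by auto
  then show ?case using set_ec_stratum_full[of S] 0 A by auto
next
  case (Suc n)
  then obtain i where i: "i \<in> V" "i \<notin> A"
    by (metis Diff_eq_empty_iff card.empty nat.distinct(1) subsetI)
  have "V - insert i A = (V - A) - {i}" by auto
  then have n: "n = card (V - insert i A)" using Suc(2) i finite_vertices by simp
  obtain e where e: "exponents i e" using exists_exponents by blast
  let ?T = "\<lambda>A S. {S'. tight S' \<and> S' \<inter> A = S}"
  have fin: "finite (?T A S)" for A S
    by (rule finite_subset[of _ "Pow V"]) (auto simp: tight_def finite_vertices)
  have "?T A S = ?T (insert i A) S \<union> ?T (insert i A) (insert i S)"
    using i Suc.prems by (auto simp: insert_eq_iff)
  moreover have "?T (insert i A) S \<inter> ?T (insert i A) (insert i S) = {}"
    using i Suc.prems by auto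
  ultimately have "card (?T A S) = card (?T (insert i A) S) + card (?T (insert i A) (insert i S))"
    using fin by (simp add: card_Un_disjoint)
  moreover have "set_ec (stratum A S) (int (card (?T (insert i A) S)) + int (card (?T (insert i A) (insert i S))))"
    by (rule set_ec_stratum_step[OF i Suc.prems e])
       (rule Suc.hyps(1)[OF n]; use i Suc.prems in auto)+
  ultimately show ?case by simp
qed

text \<open>The subspace topology from all functions agrees with that from the product over
  \<open>coords\<close>, since the further coordinates are constantly \<open>undefined\<close> on
  extensional functions.\<close>

lemma X_versal_homeomorphic: "X_versal V E M homeomorphic_space top_of_set (stratum {} {})"
  unfolding homeomorphic_space_def
proof (intro exI)
  have top: "topspace (X_versal V E M) = stratum {} {}"
    by (auto simp: X_versal_def stratum_def PiE_def)
  have "continuous_map (X_versal V E M) euclidean (\<lambda>z. z)"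
    unfolding euclidean_product_topology[symmetric] continuous_map_componentwise_UNIV
  proof
    fix c
    show "continuous_map (X_versal V E M) euclidean (\<lambda>z. z c)"
    proof (cases "c \<in> coords")
      case True
      then show ?thesis
        unfolding X_versal_def
        by (intro continuous_map_from_subtopology continuous_map_product_projection)
    next
      case False
      show ?thesis
        by (rule continuous_map_eq[of _ _ "\<lambda>_. undefined"])
           (use top False in \<open>auto simp: stratum_def extensional_def\<close>)
    qed
  qed
  moreover have "continuous_map (top_of_set (stratum {} {})) (X_versal V E M) (\<lambda>z. z)"
    unfolding X_versal_def
  proof (rule continuous_map_into_subtopology)
    show "continuous_map (top_of_set (stratum {} {})) (product_topology (\<lambda>_. euclidean) coords) (\<lambda>z. z)"
      unfolding continuous_map_componentwise
      by (auto simp: stratum_def continuous_on_coordinate)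
  qed (auto simp: stratum_def)
  ultimately show "homeomorphic_maps (X_versal V E M) (top_of_set (stratum {} {})) (\<lambda>z. z) (\<lambda>z. z)"
    using top unfolding homeomorphic_maps_def by (auto simp: continuous_map_in_subtopology)
qed

end

theorem corollary4p17:
  fixes V :: "'v set" and E M :: "'v set set"
  assumes "is_tree V E"
    and "maximum_matching V E M"
  shows "has_euler_characteristic (X_versal V E M) (int (vc V E))"
proof -
  interpret matched_graph V E M
    using assms by unfold_locales (auto simp: is_tree_def)
  have "set_ec (stratum {} {}) (int (vc V E))"
    using set_ec_stratum[of "{}" "{}"] by (simp add: vc_tight)
  then show ?thesis
    using has_euler_characteristic_homotopy_equivalent X_versal_homeomorphic
      homeomorphic_imp_homotopy_equivalent_space homeomorphic_space_sym by metis
qed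

end
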